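(* Let $f_1=(x^2+y,\,y^2+x)$ and $f_{1'}=(x^2-y^2+x,\,2xy-y)$. The restriction $O_{\mathbb{C}}(f_1)\cap\Omega_{\mathbb{R}}(2,2)$ of the generic complex orbit $O_{\mathbb{C}}(f_1)$ splits into two real orbits, which are semialgebraic and given by the sign of $\overline{\Phi}_1$: $$O_{\mathbb{R}}(f_1)=\{f\in O_{\mathbb{C}}(f_1)\cap\Omega_{\mathbb{R}}(2,2):\overline{\Phi}_1(f)<0\},\qquad O_{\mathbb{R}}(f_{1'})=\{f\in O_{\mathbb{C}}(f_1)\cap\Omega_{\mathbb{R}}(2,2):\overline{\Phi}_1(f)>0\}.$$ The first case is represented by $f_1$, with $C(f_1)=\{4xy-1=0\}$ a hyperbola and $\Delta(f_1)=\{2^8x^2y^2-2^8x^3-2^8y^3+2^5\cdot 9\,xy-27=0\}$ a reduced and irreducible curve with a cusp at $f_1\left(\frac12,\frac12\right)$. The second case is represented by $f_{1'}$, with $C(f_{1'})=\{4x^2+4y^2-1=0\}$ a circle and $\Delta(f_{1'})=\{2^{16}(x^2+y^2)^2+2^{17}(-x^3+3xy^2)+2^9\cdot 3^3\cdot 5\,(x^2+y^2)-(15)^3=0\}$ a reduced and irreducible curve with $3$ cusps at the points $f_{1'}\left(\frac14,\frac{-\sqrt3}{4}\right)$, $f_{1'}\left(\frac14,\frac{\sqrt3}{4}\right)$ and $f_{1'}\left(\frac12,0\right)$.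
   Context: For $K=\mathbb{R}$ or $\mathbb{C}$, $\Omega_K(2,2)$ is the space of polynomial mappings $f:K^2\to K^2$ with both components of degree $\le 2$; $\Omega_{\mathbb{R}}(2,2)\subset\Omega_{\mathbb{C}}(2,2)$ by viewing real polynomials as complex ones. $GA_K(2,2)$ is the group of affine automorphisms of $K^2$ and $O_K(f)=\{L\circ f\circ R:L,R\in GA_K(2,2)\}$. The orbit $O_{\mathbb{C}}(f_1)$ is the open dense orbit in $\Omega_{\mathbb{C}}(2,2)$. Write the Jacobian determinant as $J(f)=Ax^2+Bxy+Cy^2+Dx+Ey+F$; then $\overline{\Phi}_1(f)=\det\begin{pmatrix} 2A & B \\ B & 2C \end{pmatrix}=4AC-B^2$. For real $f$, $C(f)=\{J(f)=0\}\subset\mathbb{R}^2$ is the critical set and $\Delta(f)=f(C(f))$.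
   Formalization: In the equation of Δ(f_{1'}), 2^9·3^3·5 and 15^3 are replaced by 2^13·3^2 and 2^8·3^3 (the printed one fails at f_{1'}(1/2,0)=(3/4,0)); two cusps are at f_{1'}(-1/4,±√3/4), not f_{1'}(1/4,±√3/4), where the image is smooth. *)

theory Defs
  imports "HOL-Analysis.Analysis" "HOL-Computational_Algebra.Computational_Algebra"
begin

text \<open>
  A polynomial in two variables over \<open>'a\<close> is an element of \<open>'a poly poly\<close>, read as
  \<open>K[x][y]\<close>: the inner variable is \<open>x\<close>, the outer one is \<open>y\<close>.
\<close>

definition X :: "'a::comm_ring_1 poly poly" where "X = [:[:0, 1:]:]"

definition Y :: "'a::comm_ring_1 poly poly" where "Y = [:0, 1:]"

text \<open>\<open>coef p i j\<close> is the coefficient of \<open>x^i y^j\<close>.\<close>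

definition coef :: "'a::zero poly poly \<Rightarrow> nat \<Rightarrow> nat \<Rightarrow> 'a"
  where "coef p i j = coeff (coeff p j) i"

definition eval2 :: "'a::comm_ring_1 poly poly \<Rightarrow> 'a \<times> 'a \<Rightarrow> 'a"
  where "eval2 p v = poly (poly p [:snd v:]) (fst v)"

definition zero_set :: "'a::comm_ring_1 poly poly \<Rightarrow> ('a \<times> 'a) set"
  where "zero_set p = {v. eval2 p v = 0}"

definition deriv_x :: "'a::field poly poly \<Rightarrow> 'a poly poly"
  where "deriv_x p = map_poly pderiv p"

definition deriv_y :: "'a::field poly poly \<Rightarrow> 'a poly poly"
  where "deriv_y p = pderiv p"


section \<open>Polynomial mappings of the plane and their orbits\<close>

type_synonym 'a polymap = "'a poly poly \<times> 'a poly poly"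

definition mapping :: "'a::comm_ring_1 polymap \<Rightarrow> 'a \<times> 'a \<Rightarrow> 'a \<times> 'a"
  where "mapping f v = (eval2 (fst f) v, eval2 (snd f) v)"

definition total_degree_le2 :: "'a::zero poly poly \<Rightarrow> bool"
  where "total_degree_le2 p \<longleftrightarrow> (\<forall>i j. coef p i j \<noteq> 0 \<longrightarrow> i + j \<le> 2)"

definition Omega22 :: "'a::field polymap set"
  where "Omega22 = {f. total_degree_le2 (fst f) \<and> total_degree_le2 (snd f)}"

definition affine_automorphisms :: "('a::field \<times> 'a \<Rightarrow> 'a \<times> 'a) set"
  where "affine_automorphisms =
    {L. bij L \<and> (\<exists>a b c d e h. L = (\<lambda>(x, y). (a * x + b * y + e, c * x + d * y + h)))}"

text \<open>
  The composition \<open>L \<circ> f \<circ> R\<close> is taken as a composition of functions. Over the infinite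
  fields considered here a polynomial mapping is determined by its function.
\<close>

definition orbit :: "'a::field_char_0 polymap \<Rightarrow> 'a polymap set"
  where "orbit f = {g \<in> Omega22. \<exists>L\<in>affine_automorphisms. \<exists>R\<in>affine_automorphisms.
    mapping g = L \<circ> mapping f \<circ> R}"

definition complexify :: "real polymap \<Rightarrow> complex polymap"
  where "complexify f =
    (map_poly (map_poly complex_of_real) (fst f), map_poly (map_poly complex_of_real) (snd f))"

text \<open>\<open>real_part_of_orbit f\<close> is the set of real mappings in the complex orbit \<open>O\<^sub>C(f)\<close>.\<close>

definition real_part_of_orbit :: "complex polymap \<Rightarrow> real polymap set"
  where "real_part_of_orbit f = {g \<in> Omega22. complexify g \<in> orbit f}"

definition jacobian :: "'a::field polymap \<Rightarrow> 'a poly poly"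
  where "jacobian f =
    deriv_x (fst f) * deriv_y (snd f) - deriv_y (fst f) * deriv_x (snd f)"

definition Phi1 :: "'a::field polymap \<Rightarrow> 'a"
  where "Phi1 f = (let A = coef (jacobian f) 2 0; B = coef (jacobian f) 1 1;
                       C = coef (jacobian f) 0 2
                   in 4 * A * C - B\<^sup>2)"

definition critical_set :: "real polymap \<Rightarrow> (real \<times> real) set"
  where "critical_set f = zero_set (jacobian f)"

definition discriminant :: "real polymap \<Rightarrow> (real \<times> real) set"
  where "discriminant f = mapping f ` critical_set f"


section \<open>Semialgebraic sets\<close>

inductive semialgebraic :: "'a::euclidean_space set \<Rightarrow> bool" where
  eq: "real_polynomial_function p \<Longrightarrow> semialgebraic {x. p x = 0}"
| gt: "real_polynomial_function p \<Longrightarrow> semialgebraic {x. p x > 0}"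
| Un: "semialgebraic S \<Longrightarrow> semialgebraic T \<Longrightarrow> semialgebraic (S \<union> T)"
| Int: "semialgebraic S \<Longrightarrow> semialgebraic T \<Longrightarrow> semialgebraic (S \<inter> T)"
| Compl: "semialgebraic S \<Longrightarrow> semialgebraic (- S)"

text \<open>On \<open>Omega22\<close> the following is the identification of \<open>\<Omega>\<^sub>R(2,2)\<close> with \<open>R^12\<close>.\<close>

definition coords :: "'a::zero poly poly \<Rightarrow> 'a \<times> 'a \<times> 'a \<times> 'a \<times> 'a \<times> 'a"
  where "coords p = (coef p 2 0, coef p 1 1, coef p 0 2, coef p 1 0, coef p 0 1, coef p 0 0)"

definition semialgebraic_in_Omega22 :: "real polymap set \<Rightarrow> bool"
  where "semialgebraic_in_Omega22 S \<longleftrightarrow>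
    S \<subseteq> Omega22 \<and> semialgebraic ((\<lambda>f. (coords (fst f), coords (snd f))) ` S)"


section \<open>Plane curves\<close>

definition circle :: "(real \<times> real) set \<Rightarrow> bool"
  where "circle S \<longleftrightarrow> (\<exists>c r. r > 0 \<and> S = sphere c r)"

definition hyperbola :: "(real \<times> real) set \<Rightarrow> bool"
  where "hyperbola S \<longleftrightarrow> (\<exists>u v a. 0 < a \<and> 2 * a < dist u v \<and>
    S = {z. \<bar>dist z u - dist z v\<bar> = 2 * a})"

definition reduced_irreducible :: "'a::field poly poly \<Rightarrow> bool"
  where "reduced_irreducible p \<longleftrightarrow> squarefree p \<and> irreducible p"

text \<open>\<open>on_line p P v\<close> is the polynomial \<open>t \<mapsto> p(P + t v)\<close>.\<close>

definition on_line :: "'a::field poly poly \<Rightarrow> 'a \<times> 'a \<Rightarrow> 'a \<times> 'a \<Rightarrow> 'a poly"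
  where "on_line p P v =
    poly (map_poly (\<lambda>c. pcompose c [:fst P, fst v:]) p) [:snd P, snd v:]"

definition intersection_mult :: "'a::field poly poly \<Rightarrow> 'a \<times> 'a \<Rightarrow> 'a \<times> 'a \<Rightarrow> nat \<Rightarrow> bool"
  where "intersection_mult p P v k \<longleftrightarrow> on_line p P v \<noteq> 0 \<and> order 0 (on_line p P v) = k"

text \<open>
  An (ordinary) cusp is a double point with a single tangent line, which meets the curve there
  with multiplicity exactly 3. Over the reals this excludes isolated double points, which have
  no real tangent line, and nodes, which have two.
\<close>

definition cusp :: "'a::field poly poly \<Rightarrow> 'a \<times> 'a \<Rightarrow> bool"
  where "cusp p P \<longleftrightarrow> (\<exists>v. v \<noteq> (0, 0) \<and> intersection_mult p P v 3 \<and>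
    (\<forall>w. fst v * snd w \<noteq> snd v * fst w \<longrightarrow> intersection_mult p P w 2))"


section \<open>The two normal forms\<close>

definition f1 :: "'a::field polymap"
  where "f1 = (X\<^sup>2 + Y, Y\<^sup>2 + X)"

definition f1' :: "'a::field polymap"
  where "f1' = (X\<^sup>2 - Y\<^sup>2 + X, 2 * X * Y - Y)"

definition disc1 :: "'a::field poly poly"
  where "disc1 = 2^8 * X\<^sup>2 * Y\<^sup>2 - 2^8 * X^3 - 2^8 * Y^3 + 2^5 * 9 * X * Y - 27"

text \<open>
  The equation of the image of the circle \<open>4x\<^sup>2 + 4y\<^sup>2 = 1\<close> under \<open>f1'\<close>, a deltoid. The last two
  coefficients, and the sign of the first coordinate \<open>-1/4\<close> of two of the points over its cusps,
  correct misprints of the source, which has \<open>2^9 * 3^3 * 5\<close>, \<open>15^3\<close> and \<open>1/4\<close>: the point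
  \<open>(3/4, 0)\<close>, the image of the critical point \<open>(1/2, 0)\<close>, is not a zero of the printed equation,
  and with \<open>z = x + iy\<close> the restriction of \<open>f1' = z\<^sup>2 + cnj z\<close> to the circle is singular exactly
  where \<open>8 z^3 = 1\<close>.
\<close>

definition disc1' :: "'a::field poly poly"
  where "disc1' = 2^16 * (X\<^sup>2 + Y\<^sup>2)\<^sup>2 + 2^17 * (- (X^3) + 3 * X * Y\<^sup>2)
    + 2^13 * 3\<^sup>2 * (X\<^sup>2 + Y\<^sup>2) - 2^8 * 3^3"

end

theory Submission
  imports Defs
begin

text \<open>
  Two numbers attached to the Jacobian conic \<open>J(f) = Ax\<^sup>2 + Bxy + Cy\<^sup>2 + Dx + Ey + F = 0\<close> decide
  everything: \<open>Phi1 f\<close>, the discriminant \<open>4AC - B\<^sup>2\<close> of its leading form, and \<open>Psi1 f\<close>, the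
  determinant of its symmetric \<open>3 \<times> 3\<close> matrix. By the chain rule \<open>J(L \<circ> f \<circ> R)\<close> is
  \<open>det L \<cdot> det R \<cdot> J(f) \<circ> R\<close>, so along an orbit \<open>Phi1\<close> is multiplied by a nonzero square and
  \<open>Psi1\<close> by a nonzero number (\<open>orbit_invariants\<close>). Neither vanishes at \<open>f1\<close> or \<open>f1'\<close>, and
  \<open>Phi1\<close> is negative at \<open>f1\<close> and positive at \<open>f1'\<close>.

  Conversely, suppose that both are nonzero. The leading form of \<open>J(f)\<close> is the Jacobian of the two
  leading forms of \<open>f\<close> and determines the pencil that they span. If it is a product of two linear
  forms over the ground field, coordinates can be chosen in which it is a multiple of \<open>xy\<close>; the
  pencil is then spanned by \<open>x\<^sup>2\<close> and \<open>y\<^sup>2\<close>, and \<open>f\<close> becomes \<open>(x\<^sup>2 + \<beta>y, y\<^sup>2 + \<gamma>x)\<close> after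
  completing squares. Here \<open>Psi1 f \<noteq> 0\<close> says \<open>\<beta>\<gamma> \<noteq> 0\<close>, and a cube root normalizes
  \<open>\<beta> = \<gamma> = 1\<close> (\<open>orbit_f1_if\<close>). This covers all of the complex case and the real case
  \<open>Phi1 f < 0\<close>. If \<open>f\<close> is real and \<open>Phi1 f > 0\<close>, the leading form becomes a multiple of
  \<open>x\<^sup>2 + y\<^sup>2\<close>, the pencil is spanned by the real and imaginary part of \<open>z\<^sup>2\<close>, and \<open>f\<close> becomes
  \<open>z\<^sup>2 + \<beta> cnj z\<close> with \<open>\<beta> \<noteq> 0\<close>, which a complex cube root normalizes to \<open>z\<^sup>2 + cnj z\<close>, that is,
  to \<open>f1'\<close> (\<open>orbit_f1'_if\<close>). Hence the three orbits are given by \<open>Psi1 \<noteq> 0\<close> together with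
  \<open>Phi1 \<noteq> 0\<close>, \<open>Phi1 < 0\<close> and \<open>Phi1 > 0\<close>, which are polynomial conditions on the coefficients.

  The two discriminants are one complex curve: with \<open>z = x + iy\<close> the equation \<open>disc1'(x, y)\<close> is
  \<open>256 disc1(z, cnj z)\<close> (\<open>disc1'_disc1\<close>). The critical point over a point of the curve
  \<open>disc1 = 0\<close> is, away from the cusps, a rational function of that point that commutes with
  conjugation and with exchanging the coordinates; therefore every real point of either curve comes
  from a real critical point (\<open>preimage_disc1\<close>). The polynomial \<open>disc1\<close> is a cubic in \<open>y\<close> with constant leading
  coefficient and without a root in \<open>K[x]\<close>, hence irreducible, and irreducibility passes to
  \<open>disc1'\<close> by a linear change of coordinates over the complex numbers. A cusp is a singular point;
  solving for the singular points leaves one point for \<open>disc1\<close> and three for \<open>disc1'\<close>, where the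
  restriction of the equation to lines is computed.
\<close>

section \<open>Polynomials and quadratic polynomial mappings\<close>

lemma eval2_simps [simp]:
  fixes p q :: "'a::comm_ring_1 poly poly"
  shows "eval2 (p + q) v = eval2 p v + eval2 q v"
    and "eval2 (p - q) v = eval2 p v - eval2 q v"
    and "eval2 (- p) v = - eval2 p v"
    and "eval2 (p * q) v = eval2 p v * eval2 q v"
    and "eval2 (p ^ n) v = eval2 p v ^ n"
    and "eval2 0 v = 0" and "eval2 1 v = 1"
    and "eval2 (numeral k) v = numeral k"
    and "eval2 X v = fst v" and "eval2 Y v = snd v"
    and "eval2 [:[:c:]:] v = c" and "eval2 (smult r p) v = poly r (fst v) * eval2 p v"
  by (simp_all add: eval2_def X_def Y_def)

lemma eval2_eqI_infinite:
  fixes p q :: "'a::idom poly poly"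
  assumes "infinite S" and eq: "\<And>x y. x \<in> S \<Longrightarrow> y \<in> S \<Longrightarrow> eval2 p (x, y) = eval2 q (x, y)"
  shows "p = q"
proof -
  have "poly (p - q) [:y:] = 0" if "y \<in> S" for y
  proof (rule ccontr)
    assume "poly (p - q) [:y:] \<noteq> 0"
    then have "finite {x. poly (poly (p - q) [:y:]) x = 0}"
      by (rule poly_roots_finite)
    moreover have "S \<subseteq> {x. poly (poly (p - q) [:y:]) x = 0}"
      using eq that by (auto simp: eval2_def)
    ultimately show False using \<open>infinite S\<close> finite_subset by blast
  qed
  then have "(\<lambda>y. [:y:]) ` S \<subseteq> {z. poly (p - q) z = 0}"
    by auto
  moreover have "infinite ((\<lambda>y::'a. [:y:]) ` S)"
    using \<open>infinite S\<close> by (simp add: finite_image_iff inj_on_def)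
  ultimately have "infinite {z. poly (p - q) z = 0}"
    using finite_subset by blast
  then have "p - q = 0"
    using poly_roots_finite by blast
  then show ?thesis
    by simp
qed

lemma eval2_eqI:
  fixes p q :: "'a::field_char_0 poly poly"
  assumes "\<And>x y. eval2 p (x, y) = eval2 q (x, y)"
  shows "p = q"
  using eval2_eqI_infinite[OF infinite_UNIV_char_0] assms by blast

definition quad :: "'a \<Rightarrow> 'a \<Rightarrow> 'a \<Rightarrow> 'a \<Rightarrow> 'a \<Rightarrow> 'a \<Rightarrow> 'a::comm_ring_1 poly poly"
  where "quad a b c d e k = [:[:k, d, a:], [:e, b:], [:c:]:]"

lemma eval2_quad:
  "eval2 (quad a b c d e k) (x, y) = a * x\<^sup>2 + b * x * y + c * y\<^sup>2 + d * x + e * y + k"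
  by (simp add: eval2_def quad_def algebra_simps power2_eq_square)

lemma coef_quad:
  "coef (quad a b c d e k) i j = 
     (if i = 2 \<and> j = 0 then a else if i = 1 \<and> j = 1 then b else if i = 0 \<and> j = 2 then c
      else if i = 1 \<and> j = 0 then d else if i = 0 \<and> j = 1 then e else if i = 0 \<and> j = 0 then k else 0)"
  by (auto simp: coef_def quad_def coeff_pCons split: nat.splits)

lemma total_degree_le2_quad [simp]: "total_degree_le2 (quad a b c d e k)"
  by (auto simp: total_degree_le2_def coef_quad split: if_splits)

lemma coords_quad [simp]: "coords (quad a b c d e k) = (a, b, c, d, e, k)"
  by (simp add: coords_def coef_quad)

lemma quad_coefs:
  assumes "total_degree_le2 p"
  shows "p = quad (coef p 2 0) (coef p 1 1) (coef p 0 2) (coef p 1 0) (coef p 0 1) (coef p 0 0)"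
proof (rule poly_eqI, rule poly_eqI)
  fix j i
  have "i + j \<le> 2 \<or> coef p i j = 0"
    using assms by (auto simp: total_degree_le2_def)
  moreover have "i + j \<le> 2 \<Longrightarrow> (i, j) \<in> {(2, 0), (1, 1), (0, 2), (1, 0), (0, 1), (0, 0)}"
    by auto
  ultimately have "coef p i j = coef (quad (coef p 2 0) (coef p 1 1) (coef p 0 2) (coef p 1 0) (coef p 0 1) (coef p 0 0)) i j"
    by (auto simp: coef_quad)
  then show "coeff (coeff p j) i = coeff (coeff (quad (coef p 2 0) (coef p 1 1) (coef p 0 2) (coef p 1 0) (coef p 0 1) (coef p 0 0)) j) i"
    by (simp add: coef_def)
qed

lemma quad_eqD:
  assumes "quad a b c d e k = quad a' b' c' d' e' k'"
  shows "a = a' \<and> b = b' \<and> c = c' \<and> d = d' \<and> e = e' \<and> k = k'"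
  using arg_cong[OF assms, of coords] by simp

lemma Omega22_cases:
  assumes "g \<in> Omega22"
  obtains a b c d e k a' b' c' d' e' k' where
    "g = (quad a b c d e k, quad a' b' c' d' e' k')"
  using assms quad_coefs[of "fst g"] quad_coefs[of "snd g"]
  by (metis (no_types, lifting) Omega22_def mem_Collect_eq prod.collapse)

lemma jacobian_quad:
  fixes a :: "'a::field_char_0"
  shows "jacobian (quad a b c d e k, quad a' b' c' d' e' k') =
   quad (2 * (a * b' - b * a')) (4 * (a * c' - c * a')) (2 * (b * c' - c * b'))
     (2 * (a * e' - e * a') + (d * b' - b * d')) (2 * (d * c' - c * d') + (b * e' - e * b'))
     (d * e' - e * d')"
  by (simp add: jacobian_def deriv_x_def deriv_y_def quad_def map_poly_pCons pderiv_pCons algebra_simps)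

lemma f1_quad: "f1 = (quad 1 0 0 0 1 0, quad 0 0 1 1 0 0)"
  by (simp add: f1_def quad_def X_def Y_def power2_eq_square)

lemma f1'_quad: "f1' = (quad 1 0 (-1) 1 0 0, quad 0 2 0 0 (-1) 0)"
  by (simp add: f1'_def quad_def X_def Y_def power2_eq_square numeral_poly one_pCons)

section \<open>Affine automorphisms and orbits\<close>

text \<open>The rows of the augmented matrix are \<open>(a, b, e)\<close> and \<open>(c, d, h)\<close>.\<close>

definition aff :: "'a \<Rightarrow> 'a \<Rightarrow> 'a \<Rightarrow> 'a \<Rightarrow> 'a \<Rightarrow> 'a \<Rightarrow> 'a \<times> 'a \<Rightarrow> 'a::field \<times> 'a"
  where "aff a b e c d h = (\<lambda>(x, y). (a * x + b * y + e, c * x + d * y + h))"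

lemma aff_apply [simp]: "aff a b e c d h (x, y) = (a * x + b * y + e, c * x + d * y + h)"
  by (simp add: aff_def)

lemma aff_comp:
  "aff a b e c d h \<circ> aff a' b' e' c' d' h' =
   aff (a * a' + b * c') (a * b' + b * d') (a * e' + b * h' + e)
       (c * a' + d * c') (c * b' + d * d') (c * e' + d * h' + h)"
  by (rule ext) (auto simp: algebra_simps)

text \<open>Cramer's rule for the affine system.\<close>

lemma aff_inverse:
  fixes a b c d e h :: "'a::field"
  assumes "a * d - b * c \<noteq> 0"
  defines "\<delta> \<equiv> a * d - b * c"
  defines "M \<equiv> aff (d / \<delta>) (- b / \<delta>) ((b * h - d * e) / \<delta>) (- c / \<delta>) (a / \<delta>) ((c * e - a * h) / \<delta>)"
  shows "aff a b e c d h \<circ> M = id" "M \<circ> aff a b e c d h = id"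
proof -
  have "\<delta> \<noteq> 0" using assms by simp
  then show "aff a b e c d h \<circ> M = id"
    by (auto simp: fun_eq_iff M_def divide_simps) (auto simp: \<delta>_def algebra_simps)
  show "M \<circ> aff a b e c d h = id"
    using \<open>\<delta> \<noteq> 0\<close>
    by (auto simp: fun_eq_iff M_def divide_simps) (auto simp: \<delta>_def algebra_simps)
qed

text \<open>
  A vanishing determinant gives a kernel vector among \<open>(d, -c)\<close> and \<open>(b, -a)\<close>, unless the linear
  part is zero; in every case the map is not injective.
\<close>

lemma bij_aff_iff: "bij (aff a b e c d h) \<longleftrightarrow> a * d - b * c \<noteq> (0::'a::field)"
proof
  assume "a * d - b * c \<noteq> 0"
  from aff_inverse[OF this] show "bij (aff a b e c d h)"
    by (metis o_bij)
next
  assume bij: "bij (aff a b e c d h)"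
  show "a * d - b * c \<noteq> 0"
  proof
    assume det: "a * d - b * c = 0"
    have inj: "x = x' \<and> y = y'" if "aff a b e c d h (x, y) = aff a b e c d h (x', y')" for x y x' y'
      using bij that by (metis bij_is_inj injD prod.inject)
    have "aff a b e c d h (d, - c) = aff a b e c d h (0, 0)"
      using det by (simp add: algebra_simps)
    from inj[OF this] have "c = 0" "d = 0" by auto
    moreover have "aff a b e c d h (b, - a) = aff a b e c d h (0, 0)"
      using det by (simp add: algebra_simps)
    from inj[OF this] have "a = 0" "b = 0" by auto
    ultimately have "aff a b e c d h (1, 0) = aff a b e c d h (0, 0)"
      by simp
    from inj[OF this] show False by simp
  qed
qed

lemma affine_automorphisms_iff:
  "L \<in> affine_automorphisms \<longleftrightarrow>
     (\<exists>a b e c d h. L = aff a b e c d h \<and> a * d - b * c \<noteq> (0::'a::field))"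
proof -
  have "L \<in> affine_automorphisms \<longleftrightarrow> bij L \<and> (\<exists>a b c d e h. L = aff a b e c d h)"
    by (simp add: affine_automorphisms_def aff_def)
  also have "\<dots> \<longleftrightarrow> (\<exists>a b e c d h. L = aff a b e c d h \<and> a * d - b * c \<noteq> 0)"
    using bij_aff_iff by fastforce
  finally show ?thesis .
qed

lemma aff_in_affine_automorphisms:
  "a * d - b * c \<noteq> (0::'a::field) \<Longrightarrow> aff a b e c d h \<in> affine_automorphisms"
  unfolding affine_automorphisms_iff by blast

lemma affine_automorphisms_comp:
  assumes "L \<in> affine_automorphisms" "M \<in> affine_automorphisms"
  shows "L \<circ> M \<in> affine_automorphisms"
proof -
  obtain a b e c d h a' b' e' c' d' h' where LM: "L = aff a b e c d h" "M = aff a' b' e' c' d' h'"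
    using assms unfolding affine_automorphisms_iff by blast
  have "bij (L \<circ> M)"
    using assms by (auto simp: affine_automorphisms_def intro: bij_comp)
  then show ?thesis
    unfolding LM aff_comp bij_aff_iff by (rule aff_in_affine_automorphisms)
qed

lemma affine_automorphisms_inverse:
  assumes "L \<in> affine_automorphisms"
  obtains M where "M \<in> affine_automorphisms" "L \<circ> M = id" "M \<circ> L = id"
proof -
  obtain a b e c d h where L: "L = aff a b e c d h" and det: "a * d - b * c \<noteq> 0"
    using assms unfolding affine_automorphisms_iff by blast
  from aff_inverse[OF det, where e = e and h = h] obtain a' b' e' c' d' h'
    where M: "L \<circ> aff a' b' e' c' d' h' = id" "aff a' b' e' c' d' h' \<circ> L = id"
    unfolding L by blast
  then have "bij (aff a' b' e' c' d' h')" by (metis o_bij)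
  then have "aff a' b' e' c' d' h' \<in> affine_automorphisms"
    unfolding bij_aff_iff by (rule aff_in_affine_automorphisms)
  with M show ?thesis using that by blast
qed

lemma id_in_affine_automorphisms: "id \<in> (affine_automorphisms :: ('a::field \<times> 'a \<Rightarrow> 'a \<times> 'a) set)"
proof -
  have "id = (aff 1 0 0 0 1 0 :: 'a \<times> 'a \<Rightarrow> 'a \<times> 'a)" by (auto simp: fun_eq_iff)
  then show ?thesis using aff_in_affine_automorphisms[of "1::'a" 1 0 0 0 0] by simp
qed

lemma orbit_precompose:
  assumes "g \<in> Omega22" "h \<in> orbit f" "R \<in> affine_automorphisms"
    and "mapping h = mapping g \<circ> R"
  shows "g \<in> orbit f"
proof -
  obtain M where M: "M \<in> affine_automorphisms" "R \<circ> M = id"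
    using affine_automorphisms_inverse[OF assms(3)] by metis
  obtain L S where LS: "L \<in> affine_automorphisms" "S \<in> affine_automorphisms"
    "mapping h = L \<circ> mapping f \<circ> S"
    using assms(2) by (auto simp: orbit_def)
  have "mapping g = mapping g \<circ> (R \<circ> M)" using M by simp
  also have "\<dots> = L \<circ> mapping f \<circ> (S \<circ> M)"
    using LS(3) assms(4) by (metis comp_assoc)
  finally show ?thesis
    using assms(1) LS M affine_automorphisms_comp unfolding orbit_def by blast
qed

section \<open>The Jacobian conic under affine changes of coordinates\<close>

lemma quad_precompose_affine:
  "eval2 (quad a b c d e k) (aff p q s p' q' s' v) =
   eval2 (quad (a * p\<^sup>2 + b * p * p' + c * p'\<^sup>2)
     (2 * a * p * q + b * (p * q' + q * p') + 2 * c * p' * q')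
     (a * q\<^sup>2 + b * q * q' + c * q'\<^sup>2)
     (2 * a * p * s + b * (p * s' + s * p') + 2 * c * p' * s' + d * p + e * p')
     (2 * a * q * s + b * (q * s' + s * q') + 2 * c * q' * s' + d * q + e * q')
     (a * s\<^sup>2 + b * s * s' + c * s'\<^sup>2 + d * s + e * s' + k)) v"
  by (cases v) (simp add: eval2_quad power2_eq_square algebra_simps)

lemma deriv_quad:
  fixes a :: "'a::field_char_0"
  shows "deriv_x (quad a b c d e k) = quad 0 0 0 (2 * a) b d"
    and "deriv_y (quad a b c d e k) = quad 0 0 0 b (2 * c) e"
  by (simp_all add: deriv_x_def deriv_y_def quad_def map_poly_pCons pderiv_pCons)

lemma mapping_eqD:
  "mapping g = F \<Longrightarrow> F v = (eval2 (fst g) v, eval2 (snd g) v)"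
  by (auto simp: mapping_def)

text \<open>The multiplier is the determinant of the source map, by the chain rule.\<close>

lemma Omega22_precompose_affine:
  fixes g :: "'a::field_char_0 polymap"
  assumes "g \<in> Omega22"
  obtains h where "h \<in> Omega22" "mapping h = mapping g \<circ> aff p q s p' q' s'"
    "\<And>v. eval2 (jacobian h) v = (p * q' - q * p') * eval2 (jacobian g) (aff p q s p' q' s' v)"
proof -
  obtain a1 b1 c1 d1 e1 k1 a2 b2 c2 d2 e2 k2
    where g: "g = (quad a1 b1 c1 d1 e1 k1, quad a2 b2 c2 d2 e2 k2)"
    using Omega22_cases[OF assms] .
  define T where "T = (\<lambda>a b c d e k. quad (a * p\<^sup>2 + b * p * p' + c * p'\<^sup>2)
     (2 * a * p * q + b * (p * q' + q * p') + 2 * c * p' * q')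
     (a * q\<^sup>2 + b * q * q' + c * q'\<^sup>2)
     (2 * a * p * s + b * (p * s' + s * p') + 2 * c * p' * s' + d * p + e * p')
     (2 * a * q * s + b * (q * s' + s * q') + 2 * c * q' * s' + d * q + e * q')
     (a * s\<^sup>2 + b * s * s' + c * s'\<^sup>2 + d * s + e * s' + k))"
  let ?R = "aff p q s p' q' s'"
  define h where "h = (T a1 b1 c1 d1 e1 k1, T a2 b2 c2 d2 e2 k2)"
  have "h \<in> Omega22" by (simp add: h_def T_def Omega22_def)
  moreover have "mapping h = mapping g \<circ> ?R"
    unfolding g h_def T_def mapping_def by (simp only: quad_precompose_affine fst_conv snd_conv o_def)
  moreover have "eval2 (jacobian h) v = (p * q' - q * p') * eval2 (jacobian g) (?R v)" for v
  proof -
    have chain_x: "eval2 (deriv_x (T a b c d e k)) v =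
        p * eval2 (deriv_x (quad a b c d e k)) (?R v) + p' * eval2 (deriv_y (quad a b c d e k)) (?R v)"
      for a b c d e k
      by (cases v) (simp add: T_def deriv_quad eval2_quad power2_eq_square algebra_simps)
    have chain_y: "eval2 (deriv_y (T a b c d e k)) v =
        q * eval2 (deriv_x (quad a b c d e k)) (?R v) + q' * eval2 (deriv_y (quad a b c d e k)) (?R v)"
      for a b c d e k
      by (cases v) (simp add: T_def deriv_quad eval2_quad power2_eq_square algebra_simps)
    show ?thesis
      unfolding jacobian_def g h_def fst_conv snd_conv eval2_simps chain_x chain_y
      by (simp add: algebra_simps)
  qed
  ultimately show ?thesis using that by blast
qed

lemma jacobian_postcompose_affine:
  fixes g h :: "'a::field_char_0 polymap"
  assumes "g \<in> Omega22" "h \<in> Omega22" and eq: "mapping h = aff p q s p' q' s' \<circ> mapping g"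
  shows "eval2 (jacobian h) v = (p * q' - q * p') * eval2 (jacobian g) v"
proof -
  obtain a1 b1 c1 d1 e1 k1 a2 b2 c2 d2 e2 k2
    where g: "g = (quad a1 b1 c1 d1 e1 k1, quad a2 b2 c2 d2 e2 k2)"
    using Omega22_cases[OF assms(1)] .
  have eqs: "eval2 (fst h) (x, y) = p * eval2 (fst g) (x, y) + q * eval2 (snd g) (x, y) + s"
    "eval2 (snd h) (x, y) = p' * eval2 (fst g) (x, y) + q' * eval2 (snd g) (x, y) + s'" for x y
    using mapping_eqD[OF eq, of "(x, y)"] by (simp_all add: mapping_def)
  have "h = (quad (p * a1 + q * a2) (p * b1 + q * b2) (p * c1 + q * c2)
                  (p * d1 + q * d2) (p * e1 + q * e2) (p * k1 + q * k2 + s),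
             quad (p' * a1 + q' * a2) (p' * b1 + q' * b2) (p' * c1 + q' * c2)
                  (p' * d1 + q' * d2) (p' * e1 + q' * e2) (p' * k1 + q' * k2 + s'))"
    by (intro prod_eqI eval2_eqI) (simp_all add: eqs g eval2_quad algebra_simps)
  then have h: "deriv_x (fst h) = smult [:p:] (deriv_x (fst g)) + smult [:q:] (deriv_x (snd g))"
    "deriv_y (fst h) = smult [:p:] (deriv_y (fst g)) + smult [:q:] (deriv_y (snd g))"
    "deriv_x (snd h) = smult [:p':] (deriv_x (fst g)) + smult [:q':] (deriv_x (snd g))"
    "deriv_y (snd h) = smult [:p':] (deriv_y (fst g)) + smult [:q':] (deriv_y (snd g))"
    by (simp_all add: g deriv_quad) (simp_all add: quad_def algebra_simps)
  have "eval2 (smult [:c:] r) v = c * eval2 r v" for c :: 'a and r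
    by (simp add: eval2_def)
  then show ?thesis
    by (simp add: jacobian_def h algebra_simps)
qed

definition quadratic_disc :: "'a::field poly poly \<Rightarrow> 'a"
  where "quadratic_disc p = 4 * coef p 2 0 * coef p 0 2 - (coef p 1 1)\<^sup>2"

text \<open>
  The determinant of the matrix with rows \<open>(2A, B, D)\<close>, \<open>(B, 2C, E)\<close>, \<open>(D, E, 2F)\<close>.
  It vanishes exactly when the conic \<open>p = 0\<close> is degenerate.
\<close>

definition conic_disc :: "'a::field poly poly \<Rightarrow> 'a"
  where "conic_disc p = 2 * coef p 0 0 * quadratic_disc p
    - 2 * (coef p 2 0 * (coef p 0 1)\<^sup>2 - coef p 1 1 * coef p 1 0 * coef p 0 1
           + coef p 0 2 * (coef p 1 0)\<^sup>2)"

lemma disc_quad: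
  "quadratic_disc (quad a b c d e k) = 4 * a * c - b\<^sup>2"
  "conic_disc (quad a b c d e k) = 2 * k * (4 * a * c - b\<^sup>2) - 2 * (a * e\<^sup>2 - b * d * e + c * d\<^sup>2)"
  by (simp_all add: quadratic_disc_def conic_disc_def coef_quad)

lemma quad_affine_eq:
  fixes Q :: "'a::field_char_0 poly poly"
  assumes eq: "\<And>v. eval2 Q v = m * eval2 (quad a b c d e k) (aff p q s p' q' s' v)"
  defines "D \<equiv> d + 2 * a * s + b * s'" and "E \<equiv> e + b * s + 2 * c * s'"
  shows "Q = quad (m * (a * p\<^sup>2 + b * p * p' + c * p'\<^sup>2))
    (m * (2 * a * p * q + b * (p * q' + q * p') + 2 * c * p' * q'))
    (m * (a * q\<^sup>2 + b * q * q' + c * q'\<^sup>2))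
    (m * (p * D + p' * E)) (m * (q * D + q' * E))
    (m * (a * s\<^sup>2 + b * s * s' + c * s'\<^sup>2 + d * s + e * s' + k))"
  by (rule eval2_eqI)
     (simp add: eq quad_precompose_affine eval2_quad D_def E_def power2_eq_square algebra_simps)

text \<open>
  Both numbers are determinants of symmetric matrices, which an affine substitution changes by
  congruence. Splitting the substitution into its linear part and its translation keeps the
  polynomial identities small.
\<close>

lemma disc_affine:
  fixes P Q :: "'a::field_char_0 poly poly"
  assumes "total_degree_le2 P"
    and eq: "\<And>v. eval2 Q v = m * eval2 P (aff p q s p' q' s' v)"
  shows "quadratic_disc Q = (m * (p * q' - q * p'))\<^sup>2 * quadratic_disc P"
    and "conic_disc Q = m ^ 3 * (p * q' - q * p')\<^sup>2 * conic_disc P"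
proof -
  obtain a b c d e k where P: "P = quad a b c d e k"
    using quad_coefs[OF assms(1)] by blast
  define D where "D = d + 2 * a * s + b * s'"
  define E where "E = e + b * s + 2 * c * s'"
  define K where "K = a * s\<^sup>2 + b * s * s' + c * s'\<^sup>2 + d * s + e * s' + k"
  define A' where "A' = a * p\<^sup>2 + b * p * p' + c * p'\<^sup>2"
  define B' where "B' = 2 * a * p * q + b * (p * q' + q * p') + 2 * c * p' * q'"
  define C' where "C' = a * q\<^sup>2 + b * q * q' + c * q'\<^sup>2"
  have Q: "Q = quad (m * A') (m * B') (m * C') (m * (p * D + p' * E)) (m * (q * D + q' * E)) (m * K)"
    using quad_affine_eq[OF eq[unfolded P]]
    unfolding A'_def B'_def C'_def D_def E_def K_def .
  have quadratic: "4 * A' * C' - B'\<^sup>2 = (p * q' - q * p')\<^sup>2 * (4 * a * c - b\<^sup>2)"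
    by (simp add: A'_def B'_def C'_def power2_eq_square algebra_simps)
  then show "quadratic_disc Q = (m * (p * q' - q * p'))\<^sup>2 * quadratic_disc P"
    unfolding P Q disc_quad by algebra
  \<comment> \<open>The adjugate of the leading form, evaluated at the linear coefficients, picks up the same factor.\<close>
  have adjugate: "A' * (q * D + q' * E)\<^sup>2 - B' * (p * D + p' * E) * (q * D + q' * E) + C' * (p * D + p' * E)\<^sup>2
      = (p * q' - q * p')\<^sup>2 * (a * E\<^sup>2 - b * D * E + c * D\<^sup>2)"
    by (simp add: A'_def B'_def C'_def power2_eq_square algebra_simps)
  have translate: "2 * K * (4 * a * c - b\<^sup>2) - 2 * (a * E\<^sup>2 - b * D * E + c * D\<^sup>2)
      = 2 * k * (4 * a * c - b\<^sup>2) - 2 * (a * e\<^sup>2 - b * d * e + c * d\<^sup>2)"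
    by (simp add: K_def D_def E_def power2_eq_square algebra_simps)
  have "conic_disc Q = m ^ 3 * (2 * K * (4 * A' * C' - B'\<^sup>2) -
      2 * (A' * (q * D + q' * E)\<^sup>2 - B' * (p * D + p' * E) * (q * D + q' * E) + C' * (p * D + p' * E)\<^sup>2))"
    unfolding Q disc_quad by (simp add: power2_eq_square power3_eq_cube algebra_simps)
  also have "\<dots> = m ^ 3 * (p * q' - q * p')\<^sup>2 *
      (2 * K * (4 * a * c - b\<^sup>2) - 2 * (a * E\<^sup>2 - b * D * E + c * D\<^sup>2))"
    unfolding quadratic adjugate by (simp add: algebra_simps)
  also have "\<dots> = m ^ 3 * (p * q' - q * p')\<^sup>2 * conic_disc P"
    unfolding translate P disc_quad ..
  finally show "conic_disc Q = m ^ 3 * (p * q' - q * p')\<^sup>2 * conic_disc P" .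
qed

lemma Phi1_jacobian: "Phi1 g = quadratic_disc (jacobian g)"
  by (simp add: Phi1_def quadratic_disc_def Let_def)

definition Psi1 :: "'a::field polymap \<Rightarrow> 'a"
  where "Psi1 g = conic_disc (jacobian g)"

lemma jacobian_degree: "g \<in> Omega22 \<Longrightarrow> total_degree_le2 (jacobian (g :: 'a::field_char_0 polymap))"
  by (erule Omega22_cases) (simp add: jacobian_quad)

text \<open>Here \<open>m\<close> and \<open>n\<close> are the determinants of the target and the source map.\<close>

lemma orbit_invariants:
  fixes f g :: "'a::field_char_0 polymap"
  assumes "f \<in> Omega22" "g \<in> orbit f"
  obtains m n where "m \<noteq> 0" "n \<noteq> 0"
    "Phi1 g = (m * n\<^sup>2)\<^sup>2 * Phi1 f" "Psi1 g = (m * n) ^ 3 * n\<^sup>2 * Psi1 f"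
proof -
  obtain L R where LR: "L \<in> affine_automorphisms" "R \<in> affine_automorphisms"
    "mapping g = L \<circ> mapping f \<circ> R" and g: "g \<in> Omega22"
    using assms(2) unfolding orbit_def by blast
  obtain l1 l2 l3 l4 l5 l6 where L: "L = aff l1 l2 l3 l4 l5 l6" "l1 * l5 - l2 * l4 \<noteq> 0"
    using LR(1) unfolding affine_automorphisms_iff by blast
  obtain r1 r2 r3 r4 r5 r6 where R: "R = aff r1 r2 r3 r4 r5 r6" "r1 * r5 - r2 * r4 \<noteq> 0"
    using LR(2) unfolding affine_automorphisms_iff by blast
  define m where "m = l1 * l5 - l2 * l4"
  define n where "n = r1 * r5 - r2 * r4"
  obtain h where h: "h \<in> Omega22" "mapping h = mapping f \<circ> R"
    "\<And>v. eval2 (jacobian h) v = n * eval2 (jacobian f) (R v)"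
    using Omega22_precompose_affine[OF assms(1), of r1 r2 r3 r4 r5 r6]
    unfolding R(1) n_def by blast
  have "mapping g = aff l1 l2 l3 l4 l5 l6 \<circ> mapping h"
    unfolding LR(3) h(2) L(1) by (simp add: comp_assoc)
  from jacobian_postcompose_affine[OF h(1) g this]
  have "eval2 (jacobian g) v = (m * n) * eval2 (jacobian f) (aff r1 r2 r3 r4 r5 r6 v)" for v
    unfolding h(3) m_def R(1) by simp
  note disc_affine[OF jacobian_degree[OF assms(1)] this]
  then have "Phi1 g = (m * n\<^sup>2)\<^sup>2 * Phi1 f" "Psi1 g = (m * n) ^ 3 * n\<^sup>2 * Psi1 f"
    by (simp_all add: Phi1_jacobian Psi1_def n_def[symmetric] power2_eq_square mult_ac)
  moreover have "m \<noteq> 0" "n \<noteq> 0"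
    using L(2) R(2) by (simp_all add: m_def n_def)
  ultimately show ?thesis using that by blast
qed

lemma normal_forms_Omega22: "f1 \<in> Omega22" "f1' \<in> Omega22"
  by (simp_all add: Omega22_def f1_quad f1'_quad)

lemma normal_forms_invariants:
  "Phi1 (f1 :: 'a::field_char_0 polymap) = - 16" "Psi1 (f1 :: 'a polymap) = 32"
  "Phi1 (f1' :: 'a polymap) = 64" "Psi1 (f1' :: 'a polymap) = - 128"
  by (simp_all add: Phi1_jacobian Psi1_def f1_quad f1'_quad jacobian_quad disc_quad)

section \<open>The hyperbolic normal form\<close>

text \<open>A nondegenerate binary form whose discriminant is a square splits into linear factors.\<close>

lemma isotropic_basis:
  fixes A B C :: "'a::field_char_0"
  assumes "4 * A * C - B\<^sup>2 \<noteq> 0" "r\<^sup>2 = - (4 * A * C - B\<^sup>2)"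
  obtains p p' q q' where "p * q' - q * p' \<noteq> 0"
    "A * p\<^sup>2 + B * p * p' + C * p'\<^sup>2 = 0" "A * q\<^sup>2 + B * q * q' + C * q'\<^sup>2 = 0"
proof (cases "A = 0")
  case True
  then have "1 * (- B) - C * 0 \<noteq> 0" "A * 1\<^sup>2 + B * 1 * 0 + C * 0\<^sup>2 = 0" "A * C\<^sup>2 + B * C * (- B) + C * (- B)\<^sup>2 = 0"
    using assms(1) by (auto simp: power2_eq_square)
  then show ?thesis using that by blast
next
  case False
  have "r \<noteq> 0" using assms by auto
  have "A * (- B + r)\<^sup>2 + B * (- B + r) * (2 * A) + C * (2 * A)\<^sup>2 = A * (r\<^sup>2 + (4 * A * C - B\<^sup>2))"
    "A * (- B - r)\<^sup>2 + B * (- B - r) * (2 * A) + C * (2 * A)\<^sup>2 = A * (r\<^sup>2 + (4 * A * C - B\<^sup>2))"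
    by (simp_all add: power2_eq_square algebra_simps)
  moreover have "(- B + r) * (2 * A) - (- B - r) * (2 * A) = 4 * A * r"
    by (simp add: algebra_simps)
  ultimately show ?thesis
    using that[of "- B + r" "2 * A" "- B - r" "2 * A"] assms(2) False \<open>r \<noteq> 0\<close> by simp
qed

text \<open>
  If the leading forms are combinations of \<open>x\<^sup>2\<close> and \<open>y\<^sup>2\<close>, the mapping is, up to a linear map of
  the target, \<open>(x\<^sup>2 + dx + \<beta>y, y\<^sup>2 + \<gamma>x + \<epsilon>y)\<close>. The substitution \<open>x \<mapsto> \<sigma>(x + d/2)\<close>,
  \<open>y \<mapsto> \<tau>(y + \<epsilon>/2)\<close> in \<open>f1\<close> produces it exactly when \<open>\<tau> = \<beta>\<sigma>\<^sup>2\<close> and \<open>\<sigma> = \<gamma>\<tau>\<^sup>2\<close>,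
  that is, \<open>\<sigma>\<^sup>3 = 1 / (\<gamma>\<beta>\<^sup>2)\<close>.
\<close>

lemma diagonal_in_orbit_f1:
  fixes a1 c1 d1 e1 k1 a2 c2 d2 e2 k2 :: "'a::field_char_0"
  defines "h \<equiv> (quad a1 0 c1 d1 e1 k1, quad a2 0 c2 d2 e2 k2)"
  assumes det: "a1 * c2 - c1 * a2 \<noteq> 0" and Psi: "Psi1 h \<noteq> 0"
    and cube_root: "\<And>x::'a. \<exists>s. s ^ 3 = x"
  shows "h \<in> orbit f1"
proof -
  define \<Delta> where "\<Delta> = a1 * c2 - c1 * a2"
  have \<Delta>: "\<Delta> \<noteq> 0" using det by (simp add: \<Delta>_def)
  define d where "d = (d1 * c2 - c1 * d2) / \<Delta>"
  define \<gamma> where "\<gamma> = (a1 * d2 - d1 * a2) / \<Delta>"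
  define \<beta> where "\<beta> = (e1 * c2 - c1 * e2) / \<Delta>"
  define \<epsilon> where "\<epsilon> = (a1 * e2 - e1 * a2) / \<Delta>"
  have de: "d1 = a1 * d + c1 * \<gamma>" "d2 = a2 * d + c2 * \<gamma>"
    "e1 = a1 * \<beta> + c1 * \<epsilon>" "e2 = a2 * \<beta> + c2 * \<epsilon>"
    using \<Delta> by (simp_all add: d_def \<gamma>_def \<beta>_def \<epsilon>_def field_simps)
      (simp_all add: \<Delta>_def algebra_simps)
  have "Psi1 h = 32 * \<Delta> ^ 3 * \<beta> * \<gamma>"
    by (simp add: Psi1_def h_def jacobian_quad disc_quad de \<Delta>_def power2_eq_square power3_eq_cube algebra_simps)
  with Psi have \<beta>\<gamma>: "\<beta> \<noteq> 0" "\<gamma> \<noteq> 0" by auto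
  obtain \<sigma> where \<sigma>: "\<sigma> ^ 3 = 1 / (\<gamma> * \<beta>\<^sup>2)"
    using cube_root by blast
  have \<sigma>0: "\<sigma> \<noteq> 0" using \<sigma> \<beta>\<gamma> by (auto simp: zero_power)
  define \<tau> where "\<tau> = \<beta> * \<sigma>\<^sup>2"
  have \<tau>0: "\<tau> \<noteq> 0" using \<beta>\<gamma> \<sigma>0 by (simp add: \<tau>_def)
  have "\<gamma> * \<tau>\<^sup>2 = \<sigma> * (\<gamma> * \<beta>\<^sup>2 * \<sigma> ^ 3)"
    by (simp add: \<tau>_def power2_eq_square power3_eq_cube algebra_simps)
  then have \<gamma>: "\<gamma> * \<tau>\<^sup>2 = \<sigma>" using \<sigma> \<beta>\<gamma> by simp
  define R where "R = aff \<sigma> 0 (\<sigma> * d / 2) 0 \<tau> (\<tau> * \<epsilon> / 2)"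
  define U where "U = d\<^sup>2 / 4 + \<beta> * \<epsilon> / 2"
  define W where "W = \<epsilon>\<^sup>2 / 4 + \<gamma> * d / 2"
  define L where "L = aff (a1 / \<sigma>\<^sup>2) (c1 / \<tau>\<^sup>2) (k1 - a1 * U - c1 * W)
    (a2 / \<sigma>\<^sup>2) (c2 / \<tau>\<^sup>2) (k2 - a2 * U - c2 * W)"
  have "mapping h v = L (mapping f1 (R v))" for v
  proof (cases v)
    case (Pair x y)
    have 1: "(eval2 (fst f1) (R v)) / \<sigma>\<^sup>2 = (x + d / 2)\<^sup>2 + \<beta> * (y + \<epsilon> / 2)"
      using \<sigma>0 by (simp add: Pair f1_def R_def \<tau>_def power2_eq_square divide_simps algebra_simps)
    have "eval2 (snd f1) (R v) = \<tau>\<^sup>2 * (y + \<epsilon> / 2)\<^sup>2 + \<sigma> * (x + d / 2)"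
      by (simp add: Pair f1_def R_def power2_eq_square field_simps)
    also have "\<dots> = \<tau>\<^sup>2 * ((y + \<epsilon> / 2)\<^sup>2 + \<gamma> * (x + d / 2))"
      by (subst \<gamma>[symmetric]) (simp add: algebra_simps)
    finally have 2: "(eval2 (snd f1) (R v)) / \<tau>\<^sup>2 = (y + \<epsilon> / 2)\<^sup>2 + \<gamma> * (x + d / 2)"
      using \<tau>0 by simp
    have "L (mapping f1 (R v)) =
      (a1 * ((x + d / 2)\<^sup>2 + \<beta> * (y + \<epsilon> / 2)) + c1 * ((y + \<epsilon> / 2)\<^sup>2 + \<gamma> * (x + d / 2)) + (k1 - a1 * U - c1 * W),
       a2 * ((x + d / 2)\<^sup>2 + \<beta> * (y + \<epsilon> / 2)) + c2 * ((y + \<epsilon> / 2)\<^sup>2 + \<gamma> * (x + d / 2)) + (k2 - a2 * U - c2 * W))"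
      by (simp add: mapping_def L_def flip: 1 2)
    also have "\<dots> = mapping h v"
      by (simp add: Pair mapping_def h_def eval2_quad de U_def W_def power2_eq_square field_simps)
    finally show ?thesis ..
  qed
  then have "mapping h = L \<circ> mapping f1 \<circ> R" by auto
  moreover have "L \<in> affine_automorphisms"
  proof -
    have "a1 / \<sigma>\<^sup>2 * (c2 / \<tau>\<^sup>2) - c1 / \<tau>\<^sup>2 * (a2 / \<sigma>\<^sup>2) = \<Delta> / (\<sigma>\<^sup>2 * \<tau>\<^sup>2)"
      by (simp add: \<Delta>_def diff_divide_distrib mult_ac)
    then show ?thesis
      unfolding L_def using \<Delta> \<sigma>0 \<tau>0 by (intro aff_in_affine_automorphisms) simp
  qed
  moreover have "R \<in> affine_automorphisms"
    unfolding R_def using \<sigma>0 \<tau>0 by (intro aff_in_affine_automorphisms) simp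
  moreover have "h \<in> Omega22" by (simp add: h_def Omega22_def)
  ultimately show ?thesis unfolding orbit_def by blast
qed

text \<open>
  The three equations express the leading form of the Jacobian of \<open>g\<close> in the new basis
  \<open>(p, p')\<close>, \<open>(q, q')\<close> through the \<open>2 \<times> 2\<close> minors of the leading coefficients.
\<close>

lemma precompose_linear_jacobian:
  fixes g :: "'a::field_char_0 polymap"
  assumes "g \<in> Omega22" and det: "p * q' - q * p' \<noteq> 0"
    and J: "jacobian g = quad A B C D E F"
  obtains h a1 b1 c1 d1 e1 k1 a2 b2 c2 d2 e2 k2 where
    "h = (quad a1 b1 c1 d1 e1 k1, quad a2 b2 c2 d2 e2 k2)"
    "mapping h = mapping g \<circ> aff p q 0 p' q' 0"
    "h \<in> orbit g"
    "2 * (a1 * b2 - b1 * a2) = (p * q' - q * p') * (A * p\<^sup>2 + B * p * p' + C * p'\<^sup>2)"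
    "4 * (a1 * c2 - c1 * a2) = (p * q' - q * p') * (2 * A * p * q + B * (p * q' + q * p') + 2 * C * p' * q')"
    "2 * (b1 * c2 - c1 * b2) = (p * q' - q * p') * (A * q\<^sup>2 + B * q * q' + C * q'\<^sup>2)"
proof -
  obtain h where h: "h \<in> Omega22" "mapping h = mapping g \<circ> aff p q 0 p' q' 0"
    "\<And>v. eval2 (jacobian h) v = (p * q' - q * p') * eval2 (jacobian g) (aff p q 0 p' q' 0 v)"
    using Omega22_precompose_affine[OF assms(1)] by metis
  obtain a1 b1 c1 d1 e1 k1 a2 b2 c2 d2 e2 k2
    where h_eq: "h = (quad a1 b1 c1 d1 e1 k1, quad a2 b2 c2 d2 e2 k2)"
    using Omega22_cases[OF h(1)] .
  have "h \<in> orbit g"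
    unfolding orbit_def mem_Collect_eq
    using h(1,2) id_in_affine_automorphisms aff_in_affine_automorphisms[OF det] by (metis comp_id id_comp)
  moreover note quad_affine_eq[OF h(3)[unfolded J], unfolded h_eq jacobian_quad, THEN quad_eqD]
  ultimately show ?thesis using that[OF h_eq h(2)] by simp
qed

text \<open>
  In the basis of isotropic vectors of the leading form of the Jacobian, that form is a multiple of
  \<open>xy\<close>. This forces the mixed coefficients of both components to vanish.
\<close>

theorem orbit_f1_if:
  fixes g :: "'a::field_char_0 polymap"
  assumes "g \<in> Omega22" "Phi1 g \<noteq> 0" "Psi1 g \<noteq> 0" "r\<^sup>2 = - Phi1 g"
    and cube_root: "\<And>x::'a. \<exists>s. s ^ 3 = x"
  shows "g \<in> orbit f1"
proof -
  obtain A B C D E F where J: "jacobian g = quad A B C D E F"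
    using quad_coefs[OF jacobian_degree[OF assms(1)]] by blast
  have Phi: "Phi1 g = 4 * A * C - B\<^sup>2" by (simp add: Phi1_jacobian J disc_quad)
  obtain p p' q q' where basis: "p * q' - q * p' \<noteq> 0"
    "A * p\<^sup>2 + B * p * p' + C * p'\<^sup>2 = 0" "A * q\<^sup>2 + B * q * q' + C * q'\<^sup>2 = 0"
    using isotropic_basis assms(2,4) unfolding Phi by metis
  obtain h a1 b1 c1 d1 e1 k1 a2 b2 c2 d2 e2 k2
    where h: "h = (quad a1 b1 c1 d1 e1 k1, quad a2 b2 c2 d2 e2 k2)"
      "mapping h = mapping g \<circ> aff p q 0 p' q' 0" "h \<in> orbit g"
      "a1 * b2 - b1 * a2 = 0" "b1 * c2 - c1 * b2 = 0"
    using precompose_linear_jacobian[OF assms(1) basis(1) J] unfolding basis(2,3) by (metis mult_eq_0_iff zero_neq_numeral)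
  obtain m n where mn: "m \<noteq> 0" "n \<noteq> 0" "Phi1 h = (m * n\<^sup>2)\<^sup>2 * Phi1 g" "Psi1 h = (m * n) ^ 3 * n\<^sup>2 * Psi1 g"
    using orbit_invariants[OF assms(1) h(3)] .
  have "Phi1 h = - (4 * (a1 * c2 - c1 * a2))\<^sup>2"
    using h(4,5) by (simp add: Phi1_jacobian h(1) jacobian_quad disc_quad)
  moreover have "Phi1 h \<noteq> 0" "Psi1 h \<noteq> 0" using mn assms(2,3) by simp_all
  ultimately have det: "a1 * c2 - c1 * a2 \<noteq> 0" by auto
  have "b1 * (a1 * c2 - c1 * a2) = 0" "b2 * (a1 * c2 - c1 * a2) = 0"
    using h(4,5) by algebra+
  with det have "b1 = 0" "b2 = 0" by auto
  with h(1) det \<open>Psi1 h \<noteq> 0\<close> have "h \<in> orbit f1"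
    using diagonal_in_orbit_f1[OF det _ cube_root] by simp
  then show ?thesis
    using orbit_precompose[OF assms(1) _ aff_in_affine_automorphisms[OF basis(1)] h(2)] by blast
qed

section \<open>The elliptic normal form\<close>

lemma complex_cube_root: "\<exists>s. s ^ 3 = (x::complex)"
proof -
  obtain s where "x = s ^ 3"
    by (rule exists_complex_root[of 3 x]) simp
  then show ?thesis by blast
qed

text \<open>
  Comparing absolute values forces \<open>|\<sigma>| = 1 / |\<beta>|\<close>; multiplying the equation by \<open>\<sigma>\<close> then turns
  it into the equation \<open>\<sigma>\<^sup>3 = 1 / (|\<beta>|\<^sup>2 \<beta>)\<close>, whose roots have this absolute value.
\<close>

lemma conjugate_scaling:
  fixes \<beta> :: complex
  assumes "\<beta> \<noteq> 0"
  obtains \<sigma> where "\<sigma> \<noteq> 0" "cnj \<sigma> = \<beta> * \<sigma>\<^sup>2"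
proof -
  obtain \<sigma> where \<sigma>: "\<sigma> ^ 3 = 1 / ((of_real (norm \<beta>))\<^sup>2 * \<beta>)"
    using complex_cube_root by blast
  have "\<sigma> \<noteq> 0"
  proof
    assume "\<sigma> = 0"
    with \<sigma> assms show False by simp
  qed
  have "norm \<sigma> ^ 3 = (1 / norm \<beta>) ^ 3"
    using arg_cong[OF \<sigma>, of norm]
    by (simp add: norm_power norm_divide norm_mult power_divide power2_eq_square power3_eq_cube)
  then have norm: "norm \<sigma> = 1 / norm \<beta>"
    by (rule power_eq_imp_eq_base) auto
  have "\<sigma> * cnj \<sigma> = \<sigma> * (\<beta> * \<sigma>\<^sup>2)"
  proof -
    have "\<sigma> * cnj \<sigma> = (of_real (norm \<sigma>))\<^sup>2"
      using complex_norm_square[of \<sigma>] by simp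
    also have "\<dots> = \<beta> * \<sigma> ^ 3"
      unfolding \<sigma> norm using assms by (simp add: power2_eq_square)
    finally show ?thesis by (simp add: power2_eq_square power3_eq_cube)
  qed
  with \<open>\<sigma> \<noteq> 0\<close> have "cnj \<sigma> = \<beta> * \<sigma>\<^sup>2" by (metis mult_left_cancel)
  with \<open>\<sigma> \<noteq> 0\<close> show ?thesis by (rule that)
qed

lemma f1'_complex:
  "Complex (eval2 (fst f1') (Re w, Im w)) (eval2 (snd f1') (Re w, Im w)) = w\<^sup>2 + cnj w"
  by (simp add: f1'_def complex_eq_iff power2_eq_square)

text \<open>
  If the leading forms are combinations of \<open>x\<^sup>2 - y\<^sup>2\<close> and \<open>2xy\<close>, the mapping is, up to an affine
  map of the target, \<open>z\<^sup>2 + \<alpha>z + \<beta> cnj z\<close>. With \<open>w = \<sigma>(z + \<alpha>/2)\<close> and \<open>\<sigma>\<close> as in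
  \<open>conjugate_scaling\<close> this is \<open>(w\<^sup>2 + cnj w) / \<sigma>\<^sup>2\<close> up to a constant.
\<close>

lemma conformal_in_orbit_f1':
  fixes a1 b1 d1 e1 k1 a2 b2 d2 e2 k2 :: real
  defines "h \<equiv> (quad a1 b1 (- a1) d1 e1 k1, quad a2 b2 (- a2) d2 e2 k2)"
  assumes det: "a1 * b2 - b1 * a2 \<noteq> 0" and Psi: "Psi1 h \<noteq> 0"
  shows "h \<in> orbit f1'"
proof -
  define \<Delta> where "\<Delta> = a1 * b2 - b1 * a2"
  have \<Delta>: "\<Delta> \<noteq> 0" using det by (simp add: \<Delta>_def)
  define \<delta>1 where "\<delta>1 = (d1 * b2 - b1 * d2) / \<Delta>"
  define \<delta>2 where "\<delta>2 = 2 * (a1 * d2 - d1 * a2) / \<Delta>"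
  define \<eta>1 where "\<eta>1 = (e1 * b2 - b1 * e2) / \<Delta>"
  define \<eta>2 where "\<eta>2 = 2 * (a1 * e2 - e1 * a2) / \<Delta>"
  have de: "d1 = a1 * \<delta>1 + b1 * \<delta>2 / 2" "d2 = a2 * \<delta>1 + b2 * \<delta>2 / 2"
    "e1 = a1 * \<eta>1 + b1 * \<eta>2 / 2" "e2 = a2 * \<eta>1 + b2 * \<eta>2 / 2"
    using \<Delta> by (simp_all add: \<delta>1_def \<delta>2_def \<eta>1_def \<eta>2_def field_simps)
      (simp_all add: \<Delta>_def algebra_simps)
  define \<alpha> where "\<alpha> = Complex ((\<delta>1 + \<eta>2) / 2) ((\<delta>2 - \<eta>1) / 2)"
  define \<beta> where "\<beta> = Complex ((\<delta>1 - \<eta>2) / 2) ((\<eta>1 + \<delta>2) / 2)"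
  have "Psi1 h = - 4 * \<Delta> ^ 3 * ((\<delta>1 - \<eta>2)\<^sup>2 + (\<eta>1 + \<delta>2)\<^sup>2)"
    by (simp add: Psi1_def h_def jacobian_quad disc_quad de \<Delta>_def power2_eq_square power3_eq_cube field_simps)
  with Psi have "\<beta> \<noteq> 0" by (auto simp: \<beta>_def complex_eq_iff)
  then obtain \<sigma> where \<sigma>: "\<sigma> \<noteq> 0" "cnj \<sigma> = \<beta> * \<sigma>\<^sup>2"
    using conjugate_scaling by blast
  define \<kappa> where "\<kappa> = 1 / \<sigma>\<^sup>2"
  define t where "t = \<sigma> * \<alpha> / 2"
  define \<nu> where "\<nu> = \<alpha>\<^sup>2 / 4 + \<beta> * cnj \<alpha> / 2"
  define R where "R = aff (Re \<sigma>) (- Im \<sigma>) (Re t) (Im \<sigma>) (Re \<sigma>) (Im t)"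
  define L where "L = aff
    (a1 * Re \<kappa> + b1 / 2 * Im \<kappa>) (b1 / 2 * Re \<kappa> - a1 * Im \<kappa>) (k1 - a1 * Re \<nu> - b1 / 2 * Im \<nu>)
    (a2 * Re \<kappa> + b2 / 2 * Im \<kappa>) (b2 / 2 * Re \<kappa> - a2 * Im \<kappa>) (k2 - a2 * Re \<nu> - b2 / 2 * Im \<nu>)"
  have "mapping h v = L (mapping f1' (R v))" for v
  proof (cases v)
    case (Pair x y)
    define z where "z = Complex x y"
    define w where "w = \<sigma> * (z + \<alpha> / 2)"
    define p where "p = x\<^sup>2 - y\<^sup>2 + \<delta>1 * x + \<eta>1 * y"
    define q where "q = 2 * x * y + \<delta>2 * x + \<eta>2 * y"
    have R: "R v = (Re w, Im w)"
      by (simp add: Pair R_def w_def z_def t_def algebra_simps)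
    have "Complex p q = z\<^sup>2 + \<alpha> * z + \<beta> * cnj z"
      by (simp add: p_def q_def z_def \<alpha>_def \<beta>_def complex_eq_iff power2_eq_square field_simps)
    also have "\<dots> = (z + \<alpha> / 2)\<^sup>2 + \<beta> * cnj (z + \<alpha> / 2) - \<nu>"
      by (simp add: \<nu>_def power2_eq_square field_simps)
    also have "\<dots> = \<kappa> * (w\<^sup>2 + cnj w) - \<nu>"
    proof -
      have "\<kappa> * w\<^sup>2 = (z + \<alpha> / 2)\<^sup>2" "\<kappa> * cnj w = \<beta> * cnj (z + \<alpha> / 2)"
        using \<sigma>(1) unfolding w_def complex_cnj_mult \<sigma>(2) power_mult_distrib \<kappa>_def by simp_all
      then show ?thesis by (simp add: distrib_left)
    qed
    finally have pq: "Complex p q = \<kappa> * Complex (eval2 (fst f1') (R v)) (eval2 (snd f1') (R v)) - \<nu>"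
      by (simp add: R f1'_complex)
    define P where "P = eval2 (fst f1') (R v)"
    define Q where "Q = eval2 (snd f1') (R v)"
    have p: "p = Re \<kappa> * P - Im \<kappa> * Q - Re \<nu>" and q: "q = Re \<kappa> * Q + Im \<kappa> * P - Im \<nu>"
      using pq by (auto simp: complex_eq_iff P_def Q_def)
    have "mapping h v = (a1 * p + b1 / 2 * q + k1, a2 * p + b2 / 2 * q + k2)"
      by (simp add: Pair mapping_def h_def eval2_quad de p_def q_def algebra_simps)
    also have "\<dots> = L (mapping f1' (R v))"
      by (simp add: mapping_def L_def p q flip: P_def Q_def) (simp add: field_simps)
    finally show ?thesis .
  qed
  then have "mapping h = L \<circ> mapping f1' \<circ> R" by auto
  moreover have "L \<in> affine_automorphisms"
  proof -
    have "\<kappa> \<noteq> 0" using \<sigma>(1) by (simp add: \<kappa>_def)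
    then have nonzero: "\<Delta> / 2 * ((Re \<kappa>)\<^sup>2 + (Im \<kappa>)\<^sup>2) \<noteq> 0"
      using \<Delta> by (simp add: complex_eq_iff sum_power2_eq_zero_iff)
    have det_L: "(a1 * Re \<kappa> + b1 / 2 * Im \<kappa>) * (b2 / 2 * Re \<kappa> - a2 * Im \<kappa>)
      - (b1 / 2 * Re \<kappa> - a1 * Im \<kappa>) * (a2 * Re \<kappa> + b2 / 2 * Im \<kappa>) = \<Delta> / 2 * ((Re \<kappa>)\<^sup>2 + (Im \<kappa>)\<^sup>2)"
      by (simp add: \<Delta>_def power2_eq_square field_simps)
    show ?thesis
      unfolding L_def by (rule aff_in_affine_automorphisms) (use nonzero in \<open>simp only: det_L not_False_eq_True\<close>)
  qed
  moreover have "R \<in> affine_automorphisms"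
  proof -
    have "(Re \<sigma>)\<^sup>2 + (Im \<sigma>)\<^sup>2 \<noteq> 0" using \<sigma>(1) by (simp add: complex_eq_iff sum_power2_eq_zero_iff)
    then show ?thesis
      unfolding R_def by (intro aff_in_affine_automorphisms) (simp add: power2_eq_square)
  qed
  moreover have "h \<in> Omega22" by (simp add: h_def Omega22_def)
  ultimately show ?thesis unfolding orbit_def by blast
qed

text \<open>
  The basis \<open>(1, 0)\<close>, \<open>(q, q')\<close> is orthogonal for the definite leading form of the Jacobian, with
  equal values of the form, so that the form becomes a multiple of \<open>x\<^sup>2 + y\<^sup>2\<close>. This makes the
  coefficients of \<open>x\<^sup>2\<close> and \<open>y\<^sup>2\<close> opposite in both components.
\<close>

theorem orbit_f1'_if:
  fixes g :: "real polymap"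
  assumes "g \<in> Omega22" "Phi1 g > 0" "Psi1 g \<noteq> 0"
  shows "g \<in> orbit f1'"
proof -
  obtain A B C D E F where J: "jacobian g = quad A B C D E F"
    using quad_coefs[OF jacobian_degree[OF assms(1)]] by blast
  have Phi: "Phi1 g = 4 * A * C - B\<^sup>2" by (simp add: Phi1_jacobian J disc_quad)
  have "A \<noteq> 0"
  proof
    assume "A = 0"
    then have "Phi1 g = - B\<^sup>2" by (simp add: Phi)
    with assms(2) show False by simp
  qed
  define w where "w = sqrt (4 * A * C - B\<^sup>2)"
  have w: "w > 0" "w\<^sup>2 = 4 * A * C - B\<^sup>2"
    using assms(2) by (simp_all add: w_def Phi)
  define q where "q = - B / w"
  define q' where "q' = 2 * A / w"
  have basis: "1 * q' - q * 0 \<noteq> 0"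
    using \<open>A \<noteq> 0\<close> w(1) by (simp add: q'_def)
  have orthogonal: "2 * A * 1 * q + B * (1 * q' + q * 0) + 2 * C * 0 * q' = 0"
    by (simp add: q_def q'_def)
  have "A * q\<^sup>2 + B * q * q' + C * q'\<^sup>2 = A * (4 * A * C - B\<^sup>2) / w\<^sup>2"
    using w(1) by (simp add: q_def q'_def power2_eq_square field_simps)
  then have equal: "A * q\<^sup>2 + B * q * q' + C * q'\<^sup>2 = A * 1\<^sup>2 + B * 1 * 0 + C * 0\<^sup>2"
    unfolding w(2)[symmetric] using w(1) by simp
  obtain h a1 b1 c1 d1 e1 k1 a2 b2 c2 d2 e2 k2
    where h: "h = (quad a1 b1 c1 d1 e1 k1, quad a2 b2 c2 d2 e2 k2)"
      "mapping h = mapping g \<circ> aff 1 q 0 0 q' 0" "h \<in> orbit g"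
      and coefs: "2 * (a1 * b2 - b1 * a2) = (1 * q' - q * 0) * (A * 1\<^sup>2 + B * 1 * 0 + C * 0\<^sup>2)"
      "4 * (a1 * c2 - c1 * a2) = (1 * q' - q * 0) * (2 * A * 1 * q + B * (1 * q' + q * 0) + 2 * C * 0 * q')"
      "2 * (b1 * c2 - c1 * b2) = (1 * q' - q * 0) * (A * q\<^sup>2 + B * q * q' + C * q'\<^sup>2)"
    by (rule precompose_linear_jacobian[OF assms(1) basis J])
  have b: "a1 * b2 - b1 * a2 = b1 * c2 - c1 * b2"
    using coefs(1,3) unfolding equal by simp
  have c: "a1 * c2 - c1 * a2 = 0"
    using coefs(2) unfolding orthogonal by simp
  obtain m n where mn: "m \<noteq> 0" "n \<noteq> 0" "Phi1 h = (m * n\<^sup>2)\<^sup>2 * Phi1 g" "Psi1 h = (m * n) ^ 3 * n\<^sup>2 * Psi1 g"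
    using orbit_invariants[OF assms(1) h(3)] .
  have "Phi1 h = 16 * (a1 * b2 - b1 * a2) * (b1 * c2 - c1 * b2)"
    using c by (simp add: Phi1_jacobian h(1) jacobian_quad disc_quad algebra_simps)
  moreover have "Phi1 h \<noteq> 0" "Psi1 h \<noteq> 0" using mn assms(2,3) by simp_all
  ultimately have det: "a1 * b2 - b1 * a2 \<noteq> 0" by auto
  have "(a1 + c1) * (a1 * b2 - b1 * a2) = 0" "(a2 + c2) * (a1 * b2 - b1 * a2) = 0"
    using b c by algebra+
  with det have "c1 = - a1" "c2 = - a2" by auto
  with h(1) \<open>Psi1 h \<noteq> 0\<close> have "h \<in> orbit f1'"
    using conformal_in_orbit_f1'[OF det] by simp
  then show ?thesis
    using orbit_precompose[OF assms(1) _ aff_in_affine_automorphisms[OF basis] h(2)] by blast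
qed

section \<open>The real orbits and their semialgebraic description\<close>

theorem real_orbit_f1_iff:
  "g \<in> orbit (f1 :: real polymap) \<longleftrightarrow> g \<in> Omega22 \<and> Phi1 g < 0 \<and> Psi1 g \<noteq> 0"
proof
  assume g: "g \<in> orbit (f1 :: real polymap)"
  obtain m n where "m \<noteq> 0" "n \<noteq> 0"
    "Phi1 g = (m * n\<^sup>2)\<^sup>2 * (- 16)" "Psi1 g = (m * n) ^ 3 * n\<^sup>2 * 32"
    by (rule orbit_invariants[OF normal_forms_Omega22(1) g, unfolded normal_forms_invariants])
  with g show "g \<in> Omega22 \<and> Phi1 g < 0 \<and> Psi1 g \<noteq> 0"
    by (simp add: orbit_def)
next
  assume g: "g \<in> Omega22 \<and> Phi1 g < 0 \<and> Psi1 g \<noteq> 0"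
  have "\<exists>s. s ^ 3 = x" for x :: real
    using odd_real_root_pow[of 3 x] by auto
  then show "g \<in> orbit f1"
    using g by (intro orbit_f1_if[where r = "sqrt (- Phi1 g)"]) auto
qed

theorem real_orbit_f1'_iff:
  "g \<in> orbit (f1' :: real polymap) \<longleftrightarrow> g \<in> Omega22 \<and> Phi1 g > 0 \<and> Psi1 g \<noteq> 0"
proof
  assume g: "g \<in> orbit (f1' :: real polymap)"
  obtain m n where "m \<noteq> 0" "n \<noteq> 0"
    "Phi1 g = (m * n\<^sup>2)\<^sup>2 * 64" "Psi1 g = (m * n) ^ 3 * n\<^sup>2 * (- 128)"
    by (rule orbit_invariants[OF normal_forms_Omega22(2) g, unfolded normal_forms_invariants])
  with g show "g \<in> Omega22 \<and> Phi1 g > 0 \<and> Psi1 g \<noteq> 0"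
    by (simp add: orbit_def)
qed (use orbit_f1'_if in blast)

theorem complex_orbit_f1_iff:
  "g \<in> orbit (f1 :: complex polymap) \<longleftrightarrow> g \<in> Omega22 \<and> Phi1 g \<noteq> 0 \<and> Psi1 g \<noteq> 0"
proof
  assume g: "g \<in> orbit (f1 :: complex polymap)"
  obtain m n where "m \<noteq> 0" "n \<noteq> 0"
    "Phi1 g = (m * n\<^sup>2)\<^sup>2 * (- 16)" "Psi1 g = (m * n) ^ 3 * n\<^sup>2 * 32"
    by (rule orbit_invariants[OF normal_forms_Omega22(1) g, unfolded normal_forms_invariants])
  with g show "g \<in> Omega22 \<and> Phi1 g \<noteq> 0 \<and> Psi1 g \<noteq> 0"
    by (simp add: orbit_def)
next
  assume g: "g \<in> Omega22 \<and> Phi1 g \<noteq> 0 \<and> Psi1 g \<noteq> 0"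
  show "g \<in> orbit f1"
    using g complex_cube_root by (intro orbit_f1_if[where r = "csqrt (- Phi1 g)"]) auto
qed

lemma complexify_quad:
  "complexify (quad a1 b1 c1 d1 e1 k1, quad a2 b2 c2 d2 e2 k2) =
    (quad (of_real a1) (of_real b1) (of_real c1) (of_real d1) (of_real e1) (of_real k1),
     quad (of_real a2) (of_real b2) (of_real c2) (of_real d2) (of_real e2) (of_real k2))"
  by (simp add: complexify_def quad_def map_poly_pCons)

text \<open>
  The two invariants commute with complexification, and their nonvanishing describes the complex
  orbit.
\<close>

lemma real_part_of_orbit_f1_iff:
  "g \<in> real_part_of_orbit f1 \<longleftrightarrow> g \<in> Omega22 \<and> Phi1 g \<noteq> 0 \<and> Psi1 g \<noteq> 0"
proof -
  have "complexify g \<in> Omega22 \<and> Phi1 (complexify g) = of_real (Phi1 g) \<and> Psi1 (complexify g) = of_real (Psi1 g)"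
    if "g \<in> Omega22"
    using that
  proof (rule Omega22_cases)
    fix a1 b1 c1 d1 e1 k1 a2 b2 c2 d2 e2 k2
    assume g: "g = (quad a1 b1 c1 d1 e1 k1, quad a2 b2 c2 d2 e2 k2)"
    show ?thesis
      unfolding g complexify_quad Phi1_jacobian Psi1_def jacobian_quad disc_quad Omega22_def
      by (simp only: of_real_add of_real_mult of_real_diff of_real_power of_real_numeral
          mem_Collect_eq fst_conv snd_conv total_degree_le2_quad simp_thms)
  qed
  then show ?thesis
    unfolding real_part_of_orbit_def mem_Collect_eq complex_orbit_f1_iff
    by (metis of_real_eq_0_iff)
qed

lemma semialgebraic_Omega22:
  assumes "real_polynomial_function P" "real_polynomial_function Q"
  defines "c \<equiv> \<lambda>g :: real polymap. (coords (fst g), coords (snd g))"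
  shows "semialgebraic_in_Omega22 {g \<in> Omega22. 0 < P (c g) \<and> Q (c g) \<noteq> 0}"
proof -
  let ?S = "{g \<in> Omega22. 0 < P (c g) \<and> Q (c g) \<noteq> 0}"
  have onto: "\<exists>g\<in>Omega22. c g = v" for v
  proof -
    obtain a1 b1 c1 d1 e1 k1 where "fst v = (a1, b1, c1, d1, e1, k1)"
      by (rule prod_cases6)
    moreover obtain a2 b2 c2 d2 e2 k2 where "snd v = (a2, b2, c2, d2, e2, k2)"
      by (rule prod_cases6)
    ultimately have "c (quad a1 b1 c1 d1 e1 k1, quad a2 b2 c2 d2 e2 k2) = v"
      by (simp only: c_def fst_conv snd_conv coords_quad prod_eq_iff)
    moreover have "(quad a1 b1 c1 d1 e1 k1, quad a2 b2 c2 d2 e2 k2) \<in> Omega22"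
      by (simp add: Omega22_def)
    ultimately show ?thesis by (rule bexI)
  qed
  have "c ` ?S = {v. P v > 0} \<inter> - {v. Q v = 0}"
  proof (intro equalityI subsetI)
    fix v assume "v \<in> {v. P v > 0} \<inter> - {v. Q v = 0}"
    moreover obtain g where "g \<in> Omega22" "c g = v" using onto by blast
    ultimately show "v \<in> c ` ?S" by (intro image_eqI[of _ _ g]) simp_all
  next
    fix v assume "v \<in> c ` ?S"
    then obtain g where "v = c g" "g \<in> ?S" by (rule imageE)
    then show "v \<in> {v. P v > 0} \<inter> - {v. Q v = 0}" by simp
  qed
  moreover have "semialgebraic ({v. P v > 0} \<inter> - {v. Q v = 0})"
    by (rule semialgebraic.Int[OF semialgebraic.gt[OF assms(1)] semialgebraic.Compl[OF semialgebraic.eq[OF assms(2)]]])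
  ultimately have "semialgebraic (c ` ?S)" by (rule ssubst)
  then show ?thesis
    by (simp add: semialgebraic_in_Omega22_def c_def)
qed

lemma real_polynomial_function_coordinates:
  fixes u :: "'a::real_normed_vector \<Rightarrow> real \<times> real \<times> real \<times> real \<times> real \<times> real"
  assumes "bounded_linear u"
  shows "real_polynomial_function (\<lambda>v. fst (u v))"
    "real_polynomial_function (\<lambda>v. fst (snd (u v)))"
    "real_polynomial_function (\<lambda>v. fst (snd (snd (u v))))"
    "real_polynomial_function (\<lambda>v. fst (snd (snd (snd (u v)))))"
    "real_polynomial_function (\<lambda>v. fst (snd (snd (snd (snd (u v))))))"
    "real_polynomial_function (\<lambda>v. snd (snd (snd (snd (snd (u v))))))"
  by (rule real_polynomial_function.intros(1),
      intro bounded_linear_fst_comp bounded_linear_snd_comp assms)+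

lemma Phi1_Psi1_polynomial:
  "\<exists>P Q. real_polynomial_function P \<and> real_polynomial_function Q \<and>
    (\<forall>g\<in>Omega22. Phi1 g = P (coords (fst g), coords (snd g))
      \<and> Psi1 g = Q (coords (fst g), coords (snd g)))"
proof -
  let ?J = "\<lambda>v. case v of ((a1, b1, c1, d1, e1, k1), (a2, b2, c2, d2, e2, k2)) \<Rightarrow>
     jacobian (quad a1 b1 c1 d1 e1 k1, quad a2 b2 c2 d2 e2 (k2::real))"
  note coordinates = real_polynomial_function_coordinates[OF bounded_linear_fst]
    real_polynomial_function_coordinates[OF bounded_linear_snd]
  have "real_polynomial_function (\<lambda>v. quadratic_disc (?J v))"
    unfolding split_beta jacobian_quad disc_quad power2_eq_square
    by (intro real_polynomial_function.intros(2,3,4) real_polynomial_function_diff coordinates)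
  moreover have "real_polynomial_function (\<lambda>v. conic_disc (?J v))"
    unfolding split_beta jacobian_quad disc_quad power2_eq_square
    by (intro real_polynomial_function.intros(2,3,4) real_polynomial_function_diff coordinates)
  moreover have "Phi1 g = quadratic_disc (?J (coords (fst g), coords (snd g)))"
    "Psi1 g = conic_disc (?J (coords (fst g), coords (snd g)))" if "g \<in> Omega22" for g
  proof -
    from that obtain a1 b1 c1 d1 e1 k1 a2 b2 c2 d2 e2 k2
      where "g = (quad a1 b1 c1 d1 e1 k1, quad a2 b2 c2 d2 e2 k2)"
      by (rule Omega22_cases)
    then show "Phi1 g = quadratic_disc (?J (coords (fst g), coords (snd g)))"
      "Psi1 g = conic_disc (?J (coords (fst g), coords (snd g)))"
      by (simp_all only: Phi1_jacobian Psi1_def fst_conv snd_conv coords_quad prod.case)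
  qed
  ultimately show ?thesis by blast
qed

lemma semialgebraic_orbits:
  "semialgebraic_in_Omega22 (orbit (f1 :: real polymap))"
  "semialgebraic_in_Omega22 (orbit (f1' :: real polymap))"
proof -
  obtain P Q where P: "real_polynomial_function P" and Q: "real_polynomial_function Q"
    and Phi: "\<And>g. g \<in> Omega22 \<Longrightarrow> Phi1 g = P (coords (fst g), coords (snd g))"
    and Psi: "\<And>g. g \<in> Omega22 \<Longrightarrow> Psi1 g = Q (coords (fst g), coords (snd g))"
    using Phi1_Psi1_polynomial by blast
  have "orbit f1 = {g \<in> Omega22. 0 < - P (coords (fst g), coords (snd g)) \<and> Q (coords (fst g), coords (snd g)) \<noteq> 0}"
    using real_orbit_f1_iff Phi Psi by auto
  then show "semialgebraic_in_Omega22 (orbit (f1 :: real polymap))"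
    using semialgebraic_Omega22[OF real_polynomial_function_minus[OF P] Q] by simp
  have "orbit f1' = {g \<in> Omega22. 0 < P (coords (fst g), coords (snd g)) \<and> Q (coords (fst g), coords (snd g)) \<noteq> 0}"
    using real_orbit_f1'_iff Phi Psi by auto
  then show "semialgebraic_in_Omega22 (orbit (f1' :: real polymap))"
    using semialgebraic_Omega22[OF P Q] by simp
qed

section \<open>Critical sets\<close>

lemma jacobian_normal_forms:
  "jacobian (f1 :: 'a::field_char_0 polymap) = quad 0 4 0 0 0 (- 1)"
  "jacobian (f1' :: 'a polymap) = quad 4 0 4 0 0 (- 1)"
  by (simp_all add: f1_quad f1'_quad jacobian_quad)

lemma critical_set_f1: "critical_set f1 = {(x, y). 4 * x * y - 1 = 0}"
  by (auto simp: critical_set_def zero_set_def jacobian_normal_forms eval2_quad)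

lemma critical_set_f1': "critical_set f1' = {(x, y). 4 * x\<^sup>2 + 4 * y\<^sup>2 - 1 = 0}"
  by (auto simp: critical_set_def zero_set_def jacobian_normal_forms eval2_quad)

text \<open>
  The foci lie on the diagonal at distance \<open>1\<close> from the origin, and the semi-axis is \<open>1 / sqrt 2\<close>.
  With distances \<open>p\<close>, \<open>q\<close> from the foci, the focal equation is equivalent to
  \<open>pq = x\<^sup>2 + y\<^sup>2\<close>, because \<open>p\<^sup>2 + q\<^sup>2 = 2(x\<^sup>2 + y\<^sup>2) + 2\<close>.
\<close>

lemma hyperbola_xy: "hyperbola {(x, y). 4 * x * y - 1 = 0}"
proof -
  define c :: real where "c = sqrt 2 / 2"
  have c: "c > 0" "c\<^sup>2 = 1 / 2" by (simp_all add: c_def power_divide)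
  have foci: "dist (c, c) (- c, - c) = 2"
  proof -
    have "(c - - c)\<^sup>2 + (c - - c)\<^sup>2 = 2\<^sup>2"
      using c(2) by (simp add: power2_eq_square algebra_simps)
    then show ?thesis
      by (simp only: dist_Pair_Pair dist_real_def power2_abs real_sqrt_abs abs_numeral)
  qed
  have "\<bar>dist (x, y) (c, c) - dist (x, y) (- c, - c)\<bar> = 2 * c \<longleftrightarrow> 4 * x * y - 1 = 0" for x y
  proof -
    define p where "p = dist (x, y) (c, c)"
    define q where "q = dist (x, y) (- c, - c)"
    have nonneg: "p \<ge> 0" "q \<ge> 0" by (simp_all add: p_def q_def)
    have dist: "(dist (x, y) (a, b))\<^sup>2 = (x - a)\<^sup>2 + (y - b)\<^sup>2" for a b
      by (simp add: dist_Pair_Pair dist_real_def)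
    have p: "p\<^sup>2 = x\<^sup>2 + y\<^sup>2 + 1 - 2 * c * (x + y)"
      unfolding p_def dist using c(2) by (simp add: power2_diff) (simp add: algebra_simps)
    have q: "q\<^sup>2 = x\<^sup>2 + y\<^sup>2 + 1 + 2 * c * (x + y)"
      unfolding q_def dist using c(2) by (simp add: power2_sum) (simp add: algebra_simps)
    have "(p * q)\<^sup>2 = (x\<^sup>2 + y\<^sup>2 + 1)\<^sup>2 - 4 * c\<^sup>2 * (x + y)\<^sup>2"
      unfolding power_mult_distrib p q by (simp add: power2_eq_square algebra_simps)
    then have pq: "(p * q)\<^sup>2 = (x\<^sup>2 + y\<^sup>2)\<^sup>2 - (4 * x * y - 1)"
      unfolding c(2) by (simp add: power2_eq_square algebra_simps)
    have "\<bar>p - q\<bar> = 2 * c \<longleftrightarrow> \<bar>p - q\<bar>\<^sup>2 = (2 * c)\<^sup>2"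
      using c(1) by (intro power2_eq_iff_nonneg[symmetric]) simp_all
    also have "\<dots> \<longleftrightarrow> p * q = x\<^sup>2 + y\<^sup>2"
      using p q c(2) by (auto simp: power2_diff power_mult_distrib)
    also have "\<dots> \<longleftrightarrow> (p * q)\<^sup>2 = (x\<^sup>2 + y\<^sup>2)\<^sup>2"
      using nonneg by (intro power2_eq_iff_nonneg[symmetric]) simp_all
    also have "\<dots> \<longleftrightarrow> 4 * x * y - 1 = 0"
      unfolding pq by simp
    finally show ?thesis by (simp only: p_def q_def)
  qed
  then have "{(x, y). 4 * x * y - 1 = 0} = {z. \<bar>dist z (c, c) - dist z (- c, - c)\<bar> = 2 * c}"
    by auto
  moreover have "c < 1"
  proof (rule power2_less_imp_less)
    show "c\<^sup>2 < 1\<^sup>2" by (simp add: c(2))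
  qed simp
  ultimately show ?thesis
    unfolding hyperbola_def foci[symmetric] using c(1)
    by (intro exI[of _ "(c, c)"] exI[of _ "(- c, - c)"] exI[of _ c]) (simp only: foci, simp)
qed

lemma circle_half: "circle {(x, y). 4 * x\<^sup>2 + 4 * y\<^sup>2 - 1 = 0}"
proof -
  have "dist (0, 0) (x, y) = 1 / 2 \<longleftrightarrow> 4 * x\<^sup>2 + 4 * y\<^sup>2 - 1 = 0" for x y :: real
  proof -
    have "dist (0, 0) (x, y) = 1 / 2 \<longleftrightarrow> (dist (0, 0) (x, y))\<^sup>2 = (1 / 2)\<^sup>2"
      by (rule power2_eq_iff_nonneg[symmetric]) auto
    also have "(dist (0, 0) (x, y))\<^sup>2 = x\<^sup>2 + y\<^sup>2"
      by (simp add: dist_Pair_Pair dist_real_def)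
    finally show ?thesis by (auto simp: power2_eq_square)
  qed
  then have "{(x, y). 4 * x\<^sup>2 + 4 * y\<^sup>2 - 1 = 0} = sphere (0::real, 0::real) (1 / 2)"
    by (auto simp: sphere_def)
  then show ?thesis unfolding circle_def by (metis half_gt_zero zero_less_one)
qed

section \<open>Discriminant curves\<close>

lemma eval2_disc1: "eval2 disc1 (a, b) = 256 * a\<^sup>2 * b\<^sup>2 - 256 * a ^ 3 - 256 * b ^ 3 + 288 * a * b - 27"
  by (simp add: disc1_def)

lemma eval2_disc1':
  "eval2 disc1' (x, y) = 65536 * (x\<^sup>2 + y\<^sup>2)\<^sup>2 + 131072 * (3 * x * y\<^sup>2 - x ^ 3)
    + 73728 * (x\<^sup>2 + y\<^sup>2) - 6912"
  by (simp add: disc1'_def)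

lemma disc1'_disc1:
  "eval2 disc1' (x, y) = 256 * eval2 disc1 (x + \<i> * y, x - \<i> * y)"
proof -
  have prod: "(x + \<i> * y) * (x - \<i> * y) = x\<^sup>2 + y\<^sup>2"
    by (simp add: power2_eq_square algebra_simps)
  have cubes: "(x + \<i> * y) ^ 3 + (x - \<i> * y) ^ 3 = 2 * x ^ 3 - 6 * x * y\<^sup>2"
    by (simp add: power2_eq_square power3_eq_cube algebra_simps)
  have "eval2 disc1 (a, b) = 256 * (a * b)\<^sup>2 - 256 * (a ^ 3 + b ^ 3) + 288 * (a * b) - 27"
    for a b :: complex
    by (simp add: eval2_disc1 power_mult_distrib algebra_simps)
  then show ?thesis
    by (simp only: prod cubes eval2_disc1') (simp add: algebra_simps)
qed

text \<open>
  Points \<open>(x, y)\<close> with \<open>4xy = 1\<close> and \<open>f1(x, y) = (a, b)\<close> satisfy \<open>4x\<^sup>3 - 4ax + 1 = 0\<close> and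
  \<open>16x\<^sup>3 - 16bx\<^sup>2 + 1 = 0\<close>. Eliminating the cubic and then the quadratic term leaves
  \<open>(16ab\<^sup>2 + 3b - 16a\<^sup>2) x = 4b\<^sup>2 - 3a\<close>. The coefficient of \<open>x\<close> vanishes on the discriminant only
  at its cusps, where \<open>x\<close> is \<open>2b/3\<close>. Exchanging \<open>a\<close> and \<open>b\<close> gives the \<open>y\<close>-coordinate.
\<close>

definition preimage_x :: "'a::field \<Rightarrow> 'a \<Rightarrow> 'a"
  where "preimage_x a b =
    (if 16 * a * b\<^sup>2 + 3 * b - 16 * a\<^sup>2 = 0 then 2 * b / 3
     else (4 * b\<^sup>2 - 3 * a) / (16 * a * b\<^sup>2 + 3 * b - 16 * a\<^sup>2))"

text \<open>
  Multiplied by \<open>b\<^sup>2\<close>, the second equation becomes a polynomial in \<open>ab\<close> and \<open>b\<^sup>3\<close>. A combination of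
  both equations expresses \<open>ab\<close> through \<open>b\<^sup>3\<close>, and \<open>(64b\<^sup>3 - 27)\<^sup>2 = 0\<close> remains.
\<close>

lemma disc1_degenerate:
  fixes a b :: "'a::field_char_0"
  assumes D: "eval2 disc1 (a, b) = 0" and N: "16 * a * b\<^sup>2 + 3 * b - 16 * a\<^sup>2 = 0"
  shows "16 * a * b = 9" "4 * b\<^sup>2 = 3 * a" "4 * a\<^sup>2 = 3 * b"
    and "16 * b * a\<^sup>2 + 3 * a - 16 * b\<^sup>2 = 0"
proof -
  have E: "240 * (a * b) = 256 * b ^ 3 + 27"
    using D N unfolding eval2_disc1 by algebra
  have "16 * (a * b) * b ^ 3 + 3 * b ^ 3 - 16 * (a * b)\<^sup>2 = b\<^sup>2 * (16 * a * b\<^sup>2 + 3 * b - 16 * a\<^sup>2)"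
    by (simp add: power2_eq_square power3_eq_cube algebra_simps)
  then have "16 * (a * b) * b ^ 3 + 3 * b ^ 3 - 16 * (a * b)\<^sup>2 = 0"
    using N by simp
  with E have "(64 * b ^ 3 - 27)\<^sup>2 = 0" by algebra
  then have s: "64 * b ^ 3 = 27" by simp
  then have "4 * (64 * b ^ 3) = 4 * 27" by simp
  with E have "240 * (a * b) = 135" by simp
  then have ab: "15 * (16 * a * b) = 15 * 9" by simp
  then show ab: "16 * a * b = 9" by (simp only: mult_cancel_left) simp
  have "b \<noteq> 0" using ab by auto
  have "b * (4 * b\<^sup>2 - 3 * a) * 16 = 64 * b ^ 3 - 3 * (16 * a * b)"
    by (simp add: power2_eq_square power3_eq_cube algebra_simps)
  then have "b * (4 * b\<^sup>2 - 3 * a) * 16 = 0" unfolding ab s by simp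
  with \<open>b \<noteq> 0\<close> show b: "4 * b\<^sup>2 = 3 * a" by simp
  have "a * (4 * b\<^sup>2) = a * (3 * a)" by (simp add: b)
  then have "4 * (3 * a\<^sup>2) = 9 * b" using ab by algebra
  then have "3 * (4 * a\<^sup>2) = 3 * (3 * b)" by simp
  then show "4 * a\<^sup>2 = 3 * b" by (simp only: mult_cancel_left) simp
  have "16 * b * a\<^sup>2 + 3 * a - 16 * b\<^sup>2 = a * (16 * a * b) + 3 * a - 4 * (4 * b\<^sup>2)"
    by (simp add: power2_eq_square)
  then show "16 * b * a\<^sup>2 + 3 * a - 16 * b\<^sup>2 = 0"
    unfolding ab b by simp
qed

text \<open>
  Clearing denominators turns both claims into polynomial identities modulo \<open>disc1\<close>, whose
  cofactors come from polynomial division. The equation \<open>v\<^sup>2 + u = b\<close> is the second claim with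
  \<open>a\<close> and \<open>b\<close> exchanged.
\<close>

lemma preimage_disc1:
  fixes a b :: "'a::field_char_0"
  assumes D: "eval2 disc1 (a, b) = 0"
  defines "u \<equiv> preimage_x a b" and "v \<equiv> preimage_x b a"
  shows "4 * u * v = 1" "u\<^sup>2 + v = a"
proof -
  define N where "N = 16 * a * b\<^sup>2 + 3 * b - 16 * a\<^sup>2"
  define N' where "N' = 16 * b * a\<^sup>2 + 3 * a - 16 * b\<^sup>2"
  have D': "eval2 disc1 (b, a) = 0" using D by (simp add: eval2_disc1 algebra_simps)
  show "4 * u * v = 1" "u\<^sup>2 + v = a"
  proof (atomize(full), cases "N = 0")
    case True
    note * = disc1_degenerate[OF D, folded N_def, OF True]
    have "N' = 0" unfolding N'_def by (rule *(4))
    with True have uv: "u = 2 * b / 3" "v = 2 * a / 3"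
      by (simp_all add: u_def v_def preimage_x_def N_def N'_def)
    have "4 * u * v = 16 * a * b / 9" by (simp add: uv)
    moreover have "u\<^sup>2 + v = 4 * b\<^sup>2 / 9 + 2 * a / 3" by (simp add: uv power_divide)
    ultimately show "4 * u * v = 1 \<and> u\<^sup>2 + v = a" unfolding *(1,2) by simp
  next
    case False
    have "N' \<noteq> 0"
    proof
      assume "N' = 0"
      note * = disc1_degenerate[OF D', folded N'_def, OF this]
      have "N = 0" unfolding N_def by (rule *(4))
      with False show False ..
    qed
    define M where "M = 4 * b\<^sup>2 - 3 * a"
    define M' where "M' = 4 * a\<^sup>2 - 3 * b"
    have uv: "u = M / N" "v = M' / N'"
      using False \<open>N' \<noteq> 0\<close> by (simp_all add: u_def v_def preimage_x_def N_def N'_def M_def M'_def)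
    have "N * N' = 4 * M * M' + a * b * eval2 disc1 (a, b)"
      unfolding N_def N'_def M_def M'_def eval2_disc1 by algebra
    then have "4 * M * M' = N * N'" using D by simp
    moreover have "4 * u * v = 4 * M * M' / (N * N')" by (simp add: uv)
    ultimately have "4 * u * v = 1"
      using False \<open>N' \<noteq> 0\<close> by simp
    moreover have "M\<^sup>2 * N' + M' * N\<^sup>2 = a * N\<^sup>2 * N' + eval2 disc1 (a, b) *
        (16 * a ^ 4 * b - 16 * a ^ 3 * b ^ 3 - 3 * a\<^sup>2 * b\<^sup>2 - a ^ 3 + b ^ 3)"
      unfolding N_def N'_def M_def M'_def eval2_disc1 by algebra
    then have "u\<^sup>2 + v = a"
      using False \<open>N' \<noteq> 0\<close> D by (simp add: uv power_divide add_frac_eq)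
    ultimately show "4 * u * v = 1 \<and> u\<^sup>2 + v = a" ..
  qed
qed

lemma cnj_preimage_x: "cnj (preimage_x a b) = preimage_x (cnj a) (cnj b)"
proof -
  have "16 * cnj a * (cnj b)\<^sup>2 + 3 * cnj b - 16 * (cnj a)\<^sup>2 = cnj (16 * a * b\<^sup>2 + 3 * b - 16 * a\<^sup>2)"
    by simp
  then show ?thesis
    unfolding preimage_x_def by (simp only: complex_cnj_zero_iff split: if_split) simp
qed

lemma discriminant_f1: "discriminant f1 = zero_set disc1"
proof (rule equalityI; rule subsetI)
  fix z assume "z \<in> discriminant f1"
  then obtain x y :: real where "4 * x * y - 1 = 0" "z = (x\<^sup>2 + y, y\<^sup>2 + x)"
    unfolding discriminant_def critical_set_f1 by (auto simp: mapping_def f1_def)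
  moreover from this(1) have "eval2 disc1 (x\<^sup>2 + y, y\<^sup>2 + x) = 0"
    unfolding eval2_disc1 by algebra
  ultimately show "z \<in> zero_set disc1" by (simp add: zero_set_def)
next
  fix z :: "real \<times> real" assume "z \<in> zero_set disc1"
  then obtain a b where z: "z = (a, b)" and D: "eval2 disc1 (a, b) = 0"
    by (cases z) (simp add: zero_set_def)
  have D': "eval2 disc1 (b, a) = 0" using D by (simp add: eval2_disc1 algebra_simps)
  have "(preimage_x a b, preimage_x b a) \<in> critical_set f1"
    unfolding critical_set_f1 using preimage_disc1(1)[OF D] by simp
  moreover have "z = mapping f1 (preimage_x a b, preimage_x b a)"
    using preimage_disc1(2)[OF D] preimage_disc1(2)[OF D'] by (simp add: z mapping_def f1_def)
  ultimately show "z \<in> discriminant f1"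
    unfolding discriminant_def by blast
qed

text \<open>
  For \<open>b = cnj a\<close> the two coordinates of the critical point are conjugate, hence the critical point
  corresponds to a real one, on the circle \<open>4 u cnj u = 1\<close>.
\<close>

lemma discriminant_f1': "discriminant f1' = zero_set disc1'"
proof (rule equalityI; rule subsetI)
  fix z assume "z \<in> discriminant f1'"
  then obtain x y :: real where "4 * x\<^sup>2 + 4 * y\<^sup>2 - 1 = 0" "z = (x\<^sup>2 - y\<^sup>2 + x, 2 * x * y - y)"
    unfolding discriminant_def critical_set_f1' by (auto simp: mapping_def f1'_def)
  moreover from this(1) have "eval2 disc1' (x\<^sup>2 - y\<^sup>2 + x, 2 * x * y - y) = 0"
    unfolding eval2_disc1' by algebra
  ultimately show "z \<in> zero_set disc1'" by (simp add: zero_set_def)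
next
  fix z :: "real \<times> real" assume "z \<in> zero_set disc1'"
  then obtain x y where z: "z = (x, y)" and "eval2 disc1' (x, y) = 0"
    by (cases z) (simp add: zero_set_def)
  moreover have "complex_of_real (eval2 disc1' (x, y)) = eval2 disc1' (of_real x, of_real y)"
    by (simp add: eval2_disc1')
  moreover define a where "a = Complex x y"
  have "a = of_real x + \<i> * of_real y" "cnj a = of_real x - \<i> * of_real y"
    by (simp_all add: a_def complex_eq_iff)
  ultimately have D: "eval2 disc1 (a, cnj a) = 0"
    by (simp add: disc1'_disc1)
  define u where "u = preimage_x a (cnj a)"
  have cnj: "preimage_x (cnj a) a = cnj u"
    by (simp add: u_def cnj_preimage_x)
  have u: "4 * u * cnj u = 1" "u\<^sup>2 + cnj u = a"
    using preimage_disc1[OF D] unfolding cnj u_def[symmetric] .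
  have "(Re u, Im u) \<in> critical_set f1'"
    using u(1) by (simp add: critical_set_f1' complex_eq_iff power2_eq_square algebra_simps)
  moreover have "z = mapping f1' (Re u, Im u)"
    using u(2) by (simp add: z mapping_def f1'_def a_def complex_eq_iff power2_eq_square mult_ac)
  ultimately show "z \<in> discriminant f1'"
    unfolding discriminant_def by blast
qed

section \<open>Irreducibility of the discriminants\<close>

lemma irreducible_imp_squarefree:
  fixes p :: "'a::comm_semiring_1"
  assumes "irreducible p"
  shows "squarefree p"
proof (rule squarefreeI)
  fix x assume "x\<^sup>2 dvd p"
  then obtain k where "p = x * (x * k)"
    by (auto simp: power2_eq_square mult.assoc)
  with assms have "x dvd 1 \<or> x * k dvd 1" by (rule irreducibleD)
  then show "x dvd 1" by (auto intro: dvd_mult_left)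
qed

text \<open>
  Units are recognized by their values, so that this property can be transported along changes of
  coordinates and of the ground field.
\<close>

lemma is_unit_poly_poly_iff:
  fixes p :: "'a::field_char_0 poly poly"
  shows "p dvd 1 \<longleftrightarrow> (\<exists>c. c \<noteq> 0 \<and> (\<forall>x y. eval2 p (x, y) = c))"
proof
  assume "p dvd 1"
  then obtain q where q: "p = [:q:]" "q dvd 1" unfolding is_unit_poly_iff by blast
  then obtain c where "q = [:c:]" "c dvd 1" unfolding is_unit_poly_iff by blast
  with q show "\<exists>c. c \<noteq> 0 \<and> (\<forall>x y. eval2 p (x, y) = c)"
    by (intro exI[of _ c]) auto
next
  assume "\<exists>c. c \<noteq> 0 \<and> (\<forall>x y. eval2 p (x, y) = c)"
  then obtain c where c: "c \<noteq> 0" "\<And>x y. eval2 p (x, y) = c" by blast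
  have "p = [:[:c:]:]" by (rule eval2_eqI) (simp add: c(2))
  with c(1) show "p dvd 1" by (simp add: is_unit_const_poly_iff dvd_field_iff)
qed

text \<open>
  The equation reads \<open>r (288x + 256wr) = 256x\<^sup>3 + 27\<close> with \<open>w = x\<^sup>2 - r\<close>. If \<open>w \<noteq> 0\<close>, the left side
  has degree \<open>deg w + 2 deg r\<close>, which is never \<open>3\<close>; if \<open>w = 0\<close>, it has no constant term.
\<close>

lemma no_polynomial_root_disc1:
  fixes r :: "'a::field_char_0 poly"
  assumes "[:0, 288:] * r + 256 * (([:0, 1:])\<^sup>2 - r) * r * r = [:27, 0, 0, 256:]"
  shows False
proof -
  define x :: "'a poly" where "x = [:0, 1:]"
  define w where "w = x\<^sup>2 - r"
  have x2: "x\<^sup>2 = [:0, 0, 1:]" by (simp add: x_def power2_eq_square)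
  have eq: "r * ([:0, 288:] + 256 * w * r) = [:27, 0, 0, 256:]"
    using assms by (simp add: w_def x_def algebra_simps)
  show False
  proof (cases "w = 0")
    case True
    then have "r = [:0, 0, 1:]" by (simp add: w_def x2)
    with eq True show False by simp
  next
    case False
    have r0: "r \<noteq> 0" using eq by auto
    have c256: "256 * q = smult 256 q" for q :: "'a poly"
      by (simp add: numeral_poly)
    have deg: "degree (256 * w * r) = degree w + degree r"
      using False r0 by (simp add: c256 mult.assoc degree_mult_eq)
    have big: "2 \<le> degree w + degree r \<and> degree w + 2 * degree r \<noteq> 3"
    proof (cases "degree r < 2")
      case True
      have "degree w = 2"
        using True unfolding w_def x2 diff_conv_add_uminus by (subst degree_add_eq_left) simp_all
      with True show ?thesis by presburger
    qed linarith
    have "degree ([:0, 288:] + 256 * w * r) = degree w + degree r"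
      using big deg by (subst degree_add_eq_right) simp_all
    then have "degree (r * ([:0, 288:] + 256 * w * r)) = degree w + 2 * degree r"
      using r0 big by (subst degree_mult_eq) auto
    with big show False unfolding eq by simp
  qed
qed

lemma disc1_expand:
  "disc1 = [:[:- 27, 0, 0, - 256:], [:0, 288:], [:0, 0, 256:], [:- 256:] :: 'a::field_char_0 poly:]"
  by (rule eval2_eqI)
     (simp only: eval2_disc1, simp add: eval2_def power2_eq_square power3_eq_cube algebra_simps)

lemma no_linear_factor_disc1:
  fixes p q :: "'a::field_char_0 poly poly"
  assumes "p * q = disc1" "degree p = 1" "lead_coeff p = [:c:]" "c \<noteq> 0"
  shows False
proof -
  obtain e0 e1 where p: "p = [:e0, e1:]"
    using assms(2) by (metis One_nat_def degree_eq_zeroE degree_pCons_eq_if pCons_cases old.nat.inject zero_neq_one)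
  then have "e1 = [:c:]" using assms(2,3) by (simp split: if_splits)
  define r where "r = smult (- 1 / c) e0"
  have "poly p r = 0"
    using assms(4) by (simp add: p \<open>e1 = [:c:]\<close> r_def)
  then have root: "poly disc1 r = 0" by (simp flip: assms(1))
  have "poly disc1 r =
      [:- 27, 0, 0, - 256:] + r * ([:0, 288:] + r * ([:0, 0, 256:] + r * [:- 256:]))"
    unfolding disc1_expand by (simp only: poly_pCons poly_0 mult_zero_right add_0_right)
  note horner = this[unfolded root]
  have arrange: "t * r + 256 * (s - r) * r * r = - k + (k + r * (t + r * (k2 + r * k3)))"
    if "k2 = 256 * s" "k3 = - 256" for k t s k2 k3
    using that by (simp add: algebra_simps)
  have coeffs: "[:0, 0, 256:] = (256 * [:0, 1:]\<^sup>2 :: 'a poly)" "[:- 256:] = (- 256 :: 'a poly)"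
    by (simp_all add: power2_eq_square numeral_poly)
  have "[:0, 288:] * r + 256 * ([:0, 1:]\<^sup>2 - r) * r * r = - [:- 27, 0, 0, - 256:]"
    using arrange[OF coeffs, of "[:0, 288:]" "[:- 27, 0, 0, - 256:]"]
    unfolding horner[symmetric] add_0_right .
  then have "[:0, 288:] * r + 256 * ([:0, 1:]\<^sup>2 - r) * r * r = [:27, 0, 0, 256:]"
    by (simp only: minus_pCons minus_minus minus_zero)
  then show False by (rule no_polynomial_root_disc1)
qed

text \<open>
  As the leading coefficient in \<open>y\<close> is constant, so are those of the factors. A factor of degree
  \<open>0\<close> is therefore a unit, and one of degree \<open>1\<close> would yield a root in \<open>K[x]\<close>.
\<close>

theorem irreducible_disc1: "irreducible (disc1 :: 'a::field_char_0 poly poly)"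
proof (rule irreducibleI)
  show "disc1 \<noteq> (0 :: 'a poly poly)" by (simp add: disc1_expand)
  show "\<not> (disc1 :: 'a poly poly) dvd 1" by (simp add: disc1_expand is_unit_poly_iff)
next
  fix p q :: "'a poly poly" assume pq: "disc1 = p * q"
  then have nz: "p \<noteq> 0" "q \<noteq> 0" by (auto simp: disc1_expand)
  have "lead_coeff p * lead_coeff q = [:- 256:]"
    using arg_cong[OF pq, of lead_coeff] by (simp add: disc1_expand lead_coeff_mult)
  moreover have "[:- 256:] dvd (1 :: 'a poly)" by (simp add: is_unit_const_poly_iff dvd_field_iff)
  ultimately have units: "lead_coeff p dvd 1" "lead_coeff q dvd 1"
    by (metis dvd_mult_left dvd_mult_right dvd_refl dvd_trans)+
  have deg: "degree p + degree q = 3"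
    using arg_cong[OF pq, of degree] nz by (simp add: disc1_expand degree_mult_eq)
  have const: "\<exists>c. r = [:c:] \<and> c \<noteq> 0" if "r dvd 1" for r :: "'a poly"
    using that by (auto simp: is_unit_poly_iff)
  have "degree p \<noteq> 1"
    using const[OF units(1)] no_linear_factor_disc1[OF pq[symmetric]] by blast
  moreover have "degree q \<noteq> 1"
    using const[OF units(2)] no_linear_factor_disc1[of q p] pq by (metis mult.commute)
  ultimately have "degree p = 0 \<or> degree q = 0" using deg by presburger
  then show "p dvd 1 \<or> q dvd 1"
    using units by (auto elim!: degree_eq_zeroE simp: is_unit_const_poly_iff)
qed

text \<open>
  Used to transport the factors of a polynomial along a change of coordinates, whence the arbitrary
  degree.
\<close>

lemma precompose_affine_exists:
  fixes p :: "'a::field poly poly"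
  shows "\<exists>P. \<forall>v. eval2 P v = eval2 p (aff a b e c d h v)"
proof -
  let ?R = "aff a b e c d h"
  let ?u = "[:[:a:]:] * X + [:[:b:]:] * Y + [:[:e:]:]"
  let ?w = "[:[:c:]:] * X + [:[:d:]:] * Y + [:[:h:]:]"
  have R: "?R v = (eval2 ?u v, eval2 ?w v)" for v
    by (cases v) simp
  have inner: "\<exists>P. \<forall>v. eval2 P v = poly r (fst (?R v))" for r
  proof (induction r)
    case 0
    then show ?case by (intro exI[of _ 0]) simp
  next
    case (pCons k r)
    then obtain P where "\<forall>v. eval2 P v = poly r (fst (?R v))" by blast
    then show ?case
      by (intro exI[of _ "[:[:k:]:] + ?u * P"]) (simp add: R)
  qed
  show ?thesis
  proof (induction p)
    case 0
    then show ?case by (intro exI[of _ 0]) simp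
  next
    case (pCons r p)
    then obtain P where P: "\<forall>v. eval2 P v = eval2 p (?R v)" by blast
    obtain Q where Q: "\<forall>v. eval2 Q v = poly r (fst (?R v))" using inner by blast
    have "eval2 (Q + ?w * P) v = eval2 (pCons r p) (?R v)" for v
    proof -
      have "eval2 (pCons r p) (?R v) = poly r (fst (?R v)) + snd (?R v) * eval2 p (?R v)"
        by (simp add: eval2_def)
      then show ?thesis by (simp add: R P[rule_format] Q[rule_format])
    qed
    then show ?case by blast
  qed
qed

lemma irreducible_affine:
  fixes P Q :: "'a::field_char_0 poly poly"
  assumes irr: "irreducible P" and R: "R \<in> affine_automorphisms" and "k \<noteq> 0"
    and eq: "\<And>v. eval2 Q v = k * eval2 P (R v)"
  shows "irreducible Q"
proof -
  obtain M where M: "M \<in> affine_automorphisms" "R \<circ> M = id" "M \<circ> R = id"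
    using affine_automorphisms_inverse[OF R] .
  have RM: "R (M v) = v" "M (R v) = v" for v
    using fun_cong[OF M(2), of v] fun_cong[OF M(3), of v] by simp_all
  obtain a b e c d h where M_aff: "M = aff a b e c d h"
    using M(1) unfolding affine_automorphisms_iff by blast
  have eq': "eval2 P v = eval2 Q (M v) / k" for v
    using \<open>k \<noteq> 0\<close> by (simp add: eq RM)
  show ?thesis
  proof (rule irreducibleI)
    show "Q \<noteq> 0"
    proof
      assume "Q = 0"
      then have "P = 0" by (intro eval2_eqI) (simp add: eq')
      with irr show False by simp
    qed
    show "\<not> Q dvd 1"
    proof
      assume "Q dvd 1"
      then obtain z where "z \<noteq> 0" "\<And>v. eval2 Q v = z"
        unfolding is_unit_poly_poly_iff by auto
      then have "P dvd 1"
        unfolding is_unit_poly_poly_iff using \<open>k \<noteq> 0\<close> by (intro exI[of _ "z / k"]) (simp add: eq')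
      with irr show False by (simp add: irreducible_def)
    qed
  next
    fix A B assume AB: "Q = A * B"
    obtain A' where A': "\<And>v. eval2 A' v = eval2 A (M v)"
      using precompose_affine_exists[of A a b e c d h] unfolding M_aff by blast
    obtain B' where B': "\<And>v. eval2 B' v = eval2 B (M v)"
      using precompose_affine_exists[of B a b e c d h] unfolding M_aff by blast
    have "P = ([:[:1 / k:]:] * A') * B'"
      by (rule eval2_eqI) (simp add: eq' AB A' B')
    with irr have "[:[:1 / k:]:] * A' dvd 1 \<or> B' dvd 1" by (rule irreducibleD)
    then have "A' dvd 1 \<or> B' dvd 1" using dvd_mult_right by blast
    moreover have "p dvd 1" if p': "\<And>v. eval2 p' v = eval2 p (M v)" and "p' dvd 1" for p p'
    proof -
      obtain z where z: "z \<noteq> 0" "\<And>v. eval2 p' v = z"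
        using \<open>p' dvd 1\<close> unfolding is_unit_poly_poly_iff by auto
      have "eval2 p v = z" for v
        using p'[of "R v"] z(2) by (simp add: RM)
      with z(1) show ?thesis unfolding is_unit_poly_poly_iff by blast
    qed
    ultimately show "A dvd 1 \<or> B dvd 1" using A' B' by blast
  qed
qed

theorem irreducible_disc1'_complex: "irreducible (disc1' :: complex poly poly)"
proof (rule irreducible_affine[OF irreducible_disc1])
  show "aff 1 \<i> 0 1 (- \<i>) 0 \<in> affine_automorphisms"
    by (rule aff_in_affine_automorphisms) simp
  show "eval2 disc1' v = 256 * eval2 disc1 (aff 1 \<i> 0 1 (- \<i>) 0 v)" for v
    using disc1'_disc1[of "fst v" "snd v"] by (cases v) simp
qed simp

lemma eval2_complexify:
  "eval2 (map_poly (map_poly complex_of_real) p) (of_real x, of_real y) = of_real (eval2 p (x, y))"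
proof -
  have inner: "poly (map_poly complex_of_real r) (of_real x) = of_real (poly r x)" for r
    by (induction r) (simp_all add: map_poly_pCons)
  show ?thesis
    by (induction p) (simp_all add: map_poly_pCons eval2_def inner)
qed

lemma eval2_eqI_real:
  fixes p q :: "complex poly poly"
  assumes "\<And>x y. eval2 p (of_real x, of_real y) = eval2 q (of_real x, of_real y)"
  shows "p = q"
  by (rule eval2_eqI_infinite[of "range of_real"])
     (use assms in \<open>auto simp: finite_image_iff inj_on_def infinite_UNIV_char_0\<close>)

text \<open>A factorization over the real numbers is also one over the complex numbers.\<close>

theorem irreducible_disc1'_real: "irreducible (disc1' :: real poly poly)"
proof (rule irreducibleI)
  have evals: "eval2 disc1' (0, 0) = (- 6912 :: real)" "eval2 disc1' (3 / 4, 0) = (0 :: real)"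
    unfolding eval2_disc1' by (simp_all add: power_divide)
  show "disc1' \<noteq> (0 :: real poly poly)"
  proof
    assume "disc1' = (0 :: real poly poly)"
    then show False using evals(1) by simp
  qed
  show "\<not> (disc1' :: real poly poly) dvd 1"
  proof
    assume "(disc1' :: real poly poly) dvd 1"
    then obtain c where c: "\<forall>x y. eval2 disc1' (x, y) = (c :: real)"
      unfolding is_unit_poly_poly_iff by (elim exE conjE)
    have "eval2 disc1' (0, 0) = (eval2 disc1' (3 / 4, 0) :: real)"
      by (simp only: c)
    then show False unfolding evals by simp
  qed
next
  let ?c = "map_poly (map_poly complex_of_real)"
  fix A B :: "real poly poly" assume AB: "disc1' = A * B"
  have complexify: "eval2 disc1' (complex_of_real x, of_real y) = of_real (eval2 disc1' (x, y))" for x y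
    unfolding eval2_disc1'
    by (simp only: of_real_add of_real_mult of_real_diff of_real_power of_real_numeral)
  have "disc1' = ?c A * ?c B"
    by (rule eval2_eqI_real) (simp only: complexify AB eval2_simps eval2_complexify of_real_mult)
  with irreducible_disc1'_complex have "?c A dvd 1 \<or> ?c B dvd 1" by (rule irreducibleD)
  moreover have unit: "p dvd 1" if unit: "?c p dvd 1" for p
  proof -
    obtain z where z: "z \<noteq> 0" "\<forall>x y. eval2 (?c p) (x, y) = z"
      using unit unfolding is_unit_poly_poly_iff by (elim exE conjE)
    have real: "complex_of_real (eval2 p (x, y)) = z" for x y
      unfolding eval2_complexify[symmetric] by (simp only: z(2))
    have Re: "eval2 p (x, y) = Re z" for x y
      by (simp only: real[of x y, symmetric] Re_complex_of_real)
    have "Re z \<noteq> 0"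
    proof
      assume "Re z = 0"
      then have "z = 0" using real[of 0 0] by (simp only: Re of_real_0)
      with z(1) show False ..
    qed
    then show ?thesis
      unfolding is_unit_poly_poly_iff by (intro exI[of _ "Re z"]) (simp only: Re simp_thms)
  qed
  ultimately show "A dvd 1 \<or> B dvd 1" by (elim disjE) (simp_all only: unit simp_thms)
qed

section \<open>Cusps of the discriminants\<close>

lemma poly_on_line: "poly (on_line p P v) t = eval2 p (fst P + t * fst v, snd P + t * snd v)"
proof -
  let ?c = "\<lambda>c. pcompose c [:fst P, fst v:]"
  have "poly (poly (map_poly ?c p) q) t = poly (poly p [:poly q t:]) (fst P + t * fst v)" for q
    by (induction p) (simp_all add: map_poly_pCons poly_pcompose)
  then show ?thesis by (simp add: on_line_def eval2_def)
qed

lemma on_line_eqI: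
  fixes p :: "'a::field_char_0 poly poly"
  assumes "\<And>t. eval2 p (a + t * w1, b + t * w2) = poly q t"
  shows "on_line p (a, b) (w1, w2) = q"
proof -
  have "poly (on_line p (a, b) (w1, w2)) = poly q"
    by (rule ext) (simp add: poly_on_line assms)
  then show ?thesis by (simp add: poly_eq_poly_eq_iff)
qed

lemma order_0_pCons_0: "q \<noteq> 0 \<Longrightarrow> order 0 (pCons 0 q) = Suc (order 0 (q :: 'a::idom poly))"
proof -
  assume "q \<noteq> 0"
  have "order 0 [:0, 1 :: 'a:] = 1"
    using order_power_n_n[of "0::'a" 1] by simp
  with \<open>q \<noteq> 0\<close> show ?thesis
    using order_mult[of "[:0, 1:]" q 0] by simp
qed

lemma order_0_eq_0: "c \<noteq> 0 \<Longrightarrow> order 0 (pCons (c :: 'a::idom) q) = 0"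
  by (intro order_0I) simp

lemma intersection_mult_2:
  assumes "on_line p P w = [:0, 0, c2, c3, c4:]" "c2 \<noteq> 0"
  shows "intersection_mult p P w 2"
  using assms by (simp add: intersection_mult_def order_0_pCons_0 order_0_eq_0)

lemma intersection_mult_3:
  assumes "on_line p P w = [:0, 0, 0, c3, c4:]" "c3 \<noteq> 0"
  shows "intersection_mult p P w 3"
  using assms by (simp add: intersection_mult_def order_0_pCons_0 order_0_eq_0)

lemma intersection_mult_ge_2:
  assumes "intersection_mult p P w k" "2 \<le> k" "on_line p P w = pCons c0 (pCons c1 q)"
  shows "c0 = 0" "c1 = 0"
proof -
  have nz: "pCons c0 (pCons c1 q) \<noteq> 0" and ord: "order 0 (pCons c0 (pCons c1 q)) = k"
    using assms by (simp_all add: intersection_mult_def)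
  show "c0 = 0"
    using ord assms(2) order_0_eq_0[of c0] by (cases "c0 = 0") auto
  with nz ord have "Suc (order 0 (pCons c1 q)) = k" by (simp add: order_0_pCons_0)
  then show "c1 = 0"
    using assms(2) order_0_eq_0[of c1] by (cases "c1 = 0") auto
qed

lemma cuspI:
  assumes "(v1, v2) \<noteq> (0, 0)" "intersection_mult p P (v1, v2) 3"
    and "\<And>w1 w2. v1 * w2 \<noteq> v2 * w1 \<Longrightarrow> intersection_mult p P (w1, w2) 2"
  shows "cusp p P"
  unfolding cusp_def
proof (intro exI conjI allI impI)
  fix w assume "fst (v1, v2) * snd w \<noteq> snd (v1, v2) * fst w"
  then show "intersection_mult p P w 2" using assms(3)[of "snd w" "fst w"] by simp
qed (use assms(1,2) in simp_all)

text \<open>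
  The tangent direction \<open>(v1, v2)\<close> of the cusp and the orthogonal direction \<open>(-v2, v1)\<close> both meet
  the curve with multiplicity at least \<open>2\<close>, and over the reals they are independent.
\<close>

lemma cusp_singular:
  fixes p :: "real poly poly"
  assumes "cusp p (a, b)"
    and line: "\<And>w1 w2. \<exists>q. on_line p (a, b) (w1, w2) = pCons c (pCons (gx * w1 + gy * w2) q)"
  shows "c = 0" "gx = 0" "gy = 0"
proof -
  obtain v1 v2 where v: "(v1, v2) \<noteq> (0, 0)" "intersection_mult p (a, b) (v1, v2) 3"
    and other: "\<And>w1 w2. v1 * w2 \<noteq> v2 * w1 \<Longrightarrow> intersection_mult p (a, b) (w1, w2) 2"
    using assms(1) unfolding cusp_def by auto
  obtain q where "on_line p (a, b) (v1, v2) = pCons c (pCons (gx * v1 + gy * v2) q)"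
    using line by blast
  from intersection_mult_ge_2[OF v(2) _ this] have 1: "c = 0" "gx * v1 + gy * v2 = 0" by simp_all
  have nz: "v1 * v1 + v2 * v2 \<noteq> 0" using v(1) by (simp add: sum_squares_eq_zero_iff)
  have "v1 * v1 \<noteq> v2 * (- v2)"
  proof
    assume "v1 * v1 = v2 * (- v2)"
    then have "v1 * v1 + v2 * v2 = 0" by simp
    with nz show False ..
  qed
  then have mult: "intersection_mult p (a, b) (- v2, v1) 2" by (rule other)
  obtain q' where "on_line p (a, b) (- v2, v1) = pCons c (pCons (gx * (- v2) + gy * v1) q')"
    using line by blast
  from intersection_mult_ge_2[OF mult _ this] have 2: "gx * (- v2) + gy * v1 = 0" by simp
  have "gx * (v1 * v1 + v2 * v2) = v1 * (gx * v1 + gy * v2) - v2 * (gx * (- v2) + gy * v1)"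
    "gy * (v1 * v1 + v2 * v2) = v2 * (gx * v1 + gy * v2) + v1 * (gx * (- v2) + gy * v1)"
    by (simp_all add: algebra_simps)
  then show "gx = 0" "gy = 0" using 1(2) 2 nz by auto
  show "c = 0" by (rule 1(1))
qed

text \<open>
  Taylor expansion; the linear coefficient is the derivative of the equation in the direction
  \<open>(w1, w2)\<close>.
\<close>

lemma on_line_disc1:
  fixes a b :: "'a::field_char_0"
  shows "on_line disc1 (a, b) (w1, w2) =
   [:256 * a\<^sup>2 * b\<^sup>2 - 256 * a ^ 3 - 256 * b ^ 3 + 288 * a * b - 27,
     (512 * a * b\<^sup>2 - 768 * a\<^sup>2 + 288 * b) * w1 + (512 * a\<^sup>2 * b - 768 * b\<^sup>2 + 288 * a) * w2,
     256 * (b\<^sup>2 * w1\<^sup>2 + 4 * a * b * w1 * w2 + a\<^sup>2 * w2\<^sup>2) - 768 * (a * w1\<^sup>2 + b * w2\<^sup>2) + 288 * w1 * w2,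
     512 * (b * w1\<^sup>2 * w2 + a * w1 * w2\<^sup>2) - 256 * (w1 ^ 3 + w2 ^ 3),
     256 * w1\<^sup>2 * w2\<^sup>2:]"
  by (rule on_line_eqI)
     (simp add: eval2_disc1 power2_eq_square power3_eq_cube algebra_simps)

lemma on_line_disc1':
  fixes x y w1 w2 :: "'a::field_char_0"
  defines "r \<equiv> x\<^sup>2 + y\<^sup>2" and "s \<equiv> x * w1 + y * w2" and "w \<equiv> w1\<^sup>2 + w2\<^sup>2"
  shows "on_line disc1' (x, y) (w1, w2) =
   [:65536 * r\<^sup>2 + 131072 * (3 * x * y\<^sup>2 - x ^ 3) + 73728 * r - 6912,
     (262144 * r * x + 393216 * (y\<^sup>2 - x\<^sup>2) + 147456 * x) * w1
       + (262144 * r * y + 786432 * x * y + 147456 * y) * w2,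
     65536 * (4 * s\<^sup>2 + 2 * r * w) + 393216 * (x * w2\<^sup>2 + 2 * y * w1 * w2 - x * w1\<^sup>2) + 73728 * w,
     262144 * s * w + 131072 * (3 * w1 * w2\<^sup>2 - w1 ^ 3),
     65536 * w\<^sup>2:]"
proof (rule on_line_eqI)
  fix t
  have *: "(x + t * w1)\<^sup>2 + (y + t * w2)\<^sup>2 = r + t * (2 * s + t * w)"
    by (simp add: r_def s_def w_def power2_eq_square algebra_simps)
  have r: "r * x * w1 + r * y * w2 = r * s"
    by (simp add: s_def algebra_simps)
  show "eval2 disc1' (x + t * w1, y + t * w2) = poly
   [:65536 * r\<^sup>2 + 131072 * (3 * x * y\<^sup>2 - x ^ 3) + 73728 * r - 6912,
     (262144 * r * x + 393216 * (y\<^sup>2 - x\<^sup>2) + 147456 * x) * w1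
       + (262144 * r * y + 786432 * x * y + 147456 * y) * w2,
     65536 * (4 * s\<^sup>2 + 2 * r * w) + 393216 * (x * w2\<^sup>2 + 2 * y * w1 * w2 - x * w1\<^sup>2) + 73728 * w,
     262144 * s * w + 131072 * (3 * w1 * w2\<^sup>2 - w1 ^ 3),
     65536 * w\<^sup>2:] t"
    unfolding eval2_disc1' * poly_pCons poly_0
    by (simp add: s_def power2_eq_square power3_eq_cube algebra_simps)
qed

text \<open>
  At a singular point \<open>aF\<^sub>a - bF\<^sub>b = 768(b\<^sup>3 - a\<^sup>3)\<close> vanishes, which confines real singular points to
  the diagonal. There the quadratic term \<open>-432(w1 - w2)\<^sup>2\<close> singles out the tangent direction.
\<close>

theorem cusps_disc1: "{P. cusp (disc1 :: real poly poly) P} = {(3 / 4, 3 / 4)}"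
proof (intro equalityI subsetI)
  fix P assume P: "P \<in> {P. cusp (disc1 :: real poly poly) P}"
  obtain a b where ab: "P = (a, b)" by (cases P)
  from P have cusp: "cusp disc1 (a, b)" by (simp add: ab)
  have line: "\<exists>q. on_line disc1 (a, b) (w1, w2) =
      pCons (256 * a\<^sup>2 * b\<^sup>2 - 256 * a ^ 3 - 256 * b ^ 3 + 288 * a * b - 27)
      (pCons ((512 * a * b\<^sup>2 - 768 * a\<^sup>2 + 288 * b) * w1 + (512 * a\<^sup>2 * b - 768 * b\<^sup>2 + 288 * a) * w2) q)"
    for w1 w2
    unfolding on_line_disc1 by blast
  note sing = cusp_singular[OF cusp line]
  have "a * (512 * a * b\<^sup>2 - 768 * a\<^sup>2 + 288 * b) - b * (512 * a\<^sup>2 * b - 768 * b\<^sup>2 + 288 * a) = 768 * (b ^ 3 - a ^ 3)"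
    by (simp add: power2_eq_square power3_eq_cube algebra_simps)
  then have "a ^ 3 = b ^ 3" unfolding sing(2,3) by simp
  then have "root 3 (a ^ 3) = root 3 (b ^ 3)" by simp
  moreover have "root 3 (x ^ 3) = x" for x
    by (rule odd_real_root_power_cancel) simp
  ultimately have "a = b" by simp
  have "512 * a * b\<^sup>2 - 768 * a\<^sup>2 + 288 * b = 32 * a * (4 * a - 3)\<^sup>2"
    by (simp add: \<open>a = b\<close> power2_eq_square algebra_simps)
  then have "a = 0 \<or> a = 3 / 4" unfolding sing(2) by auto
  moreover have "a \<noteq> 0"
  proof
    assume "a = 0"
    with \<open>a = b\<close> have "b = 0" by simp
    with \<open>a = 0\<close> sing(1) show False by simp
  qed
  ultimately show "P \<in> {(3 / 4, 3 / 4)}" using \<open>a = b\<close> by (simp add: ab)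
next
  fix P :: "real \<times> real" assume "P \<in> {(3 / 4, 3 / 4)}"
  then have P: "P = (3 / 4, 3 / 4)" by simp
  have tangent: "on_line disc1 P (1, 1) = [:0, 0, 0, 256, 256:]"
    unfolding P on_line_disc1 by (simp add: power2_eq_square power3_eq_cube)
  have line: "on_line disc1 P (w1, w2) =
      [:0, 0, - 432 * (w1 - w2)\<^sup>2, 384 * (w1\<^sup>2 * w2 + w1 * w2\<^sup>2) - 256 * (w1 ^ 3 + w2 ^ 3), 256 * w1\<^sup>2 * w2\<^sup>2:]"
    for w1 w2
    unfolding P on_line_disc1 by (simp add: power2_eq_square power3_eq_cube algebra_simps)
  have "cusp disc1 P"
  proof (rule cuspI[OF _ intersection_mult_3[OF tangent]])
    show "intersection_mult disc1 P (w1, w2) 2" if "1 * w2 \<noteq> 1 * w1" for w1 w2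
      by (rule intersection_mult_2[OF line]) (use that in simp)
  qed simp_all
  then show "P \<in> {P. cusp disc1 P}" by simp
qed

text \<open>
  Singular points off the axis \<open>y = 0\<close> satisfy \<open>y\<^sup>2 = 3x\<^sup>2\<close>, in accordance with the threefold
  symmetry of the deltoid. At each cusp the tangent passes through the origin.
\<close>

theorem cusps_disc1':
  "{P. cusp (disc1' :: real poly poly) P} =
    {(- 3 / 8, 3 * sqrt 3 / 8), (- 3 / 8, - 3 * sqrt 3 / 8), (3 / 4, 0)}"
proof (intro equalityI subsetI)
  fix P :: "real \<times> real" assume P: "P \<in> {P. cusp (disc1' :: real poly poly) P}"
  obtain x y where xy: "P = (x, y)" by (cases P)
  from P have cusp: "cusp disc1' (x, y)" by (simp add: xy)
  let ?F = "65536 * (x\<^sup>2 + y\<^sup>2)\<^sup>2 + 131072 * (3 * x * y\<^sup>2 - x ^ 3) + 73728 * (x\<^sup>2 + y\<^sup>2) - 6912"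
  let ?Fx = "262144 * (x\<^sup>2 + y\<^sup>2) * x + 393216 * (y\<^sup>2 - x\<^sup>2) + 147456 * x"
  let ?Fy = "262144 * (x\<^sup>2 + y\<^sup>2) * y + 786432 * x * y + 147456 * y"
  have line: "\<exists>q. on_line disc1' (x, y) (w1, w2) = pCons ?F (pCons (?Fx * w1 + ?Fy * w2) q)" for w1 w2
    unfolding on_line_disc1' by blast
  note sing = cusp_singular[OF cusp line]
  show "P \<in> {(- 3 / 8, 3 * sqrt 3 / 8), (- 3 / 8, - 3 * sqrt 3 / 8), (3 / 4, 0)}"
  proof (cases "y = 0")
    case True
    have "?Fx = 16384 * x * (4 * x - 3)\<^sup>2"
      by (simp add: True power2_eq_square algebra_simps)
    then have "x = 0 \<or> x = 3 / 4" unfolding sing(2) by auto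
    moreover have "x \<noteq> 0"
    proof
      assume "x = 0"
      with True sing(1) show False by simp
    qed
    ultimately show ?thesis by (simp add: xy True)
  next
    case False
    have "?Fy = y * (262144 * (x\<^sup>2 + y\<^sup>2) + 786432 * x + 147456)"
      by (simp add: algebra_simps)
    with False have r: "16 * (x\<^sup>2 + y\<^sup>2) = - 48 * x - 9" unfolding sing(3) by simp
    have "?Fx = 16384 * (x * (16 * (x\<^sup>2 + y\<^sup>2)) + 24 * (y\<^sup>2 - x\<^sup>2) + 9 * x)"
      by (simp add: algebra_simps)
    also have "\<dots> = 16384 * 24 * (y\<^sup>2 - 3 * x\<^sup>2)"
      unfolding r by (simp add: power2_eq_square algebra_simps)
    finally have y2: "y\<^sup>2 = 3 * x\<^sup>2" unfolding sing(2) by simp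
    with r have "(8 * x + 3)\<^sup>2 = 0" by (simp add: power2_eq_square algebra_simps)
    then have x: "x = - 3 / 8" by simp
    have "y\<^sup>2 = (3 * sqrt 3 / 8)\<^sup>2"
      unfolding y2 x by (simp add: power_mult_distrib power_divide)
    then have "y = 3 * sqrt 3 / 8 \<or> y = - (3 * sqrt 3 / 8)" by (simp only: power2_eq_iff)
    then show ?thesis by (auto simp: xy x)
  qed
next
  fix P :: "real \<times> real" assume "P \<in> {(- 3 / 8, 3 * sqrt 3 / 8), (- 3 / 8, - 3 * sqrt 3 / 8), (3 / 4, 0)}"
  then consider \<sigma> where "\<sigma>\<^sup>2 = 3" "P = (- 3 / 8, 3 * \<sigma> / 8)" | "P = (3 / 4, 0)"
  proof (elim insertE emptyE)
    assume "P = (- 3 / 8, 3 * sqrt 3 / 8)"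
    then show thesis using that(1)[of "sqrt 3"] by simp
  next
    assume "P = (- 3 / 8, - 3 * sqrt 3 / 8)"
    then show thesis using that(1)[of "- sqrt 3"] by simp
  qed
  then show "P \<in> {P. cusp disc1' P}"
  proof cases
    case (1 \<sigma>)
    have \<sigma>: "\<sigma> * \<sigma> = 3" "\<And>z. \<sigma> * (\<sigma> * z) = 3 * z"
      using 1(1) by (simp_all add: power2_eq_square flip: mult.assoc)
    have line: "on_line disc1' P (w1, w2) =
        [:0, 0, 110592 * (\<sigma> * w1 + w2)\<^sup>2,
          98304 * (\<sigma> * w2 - w1) * (w1\<^sup>2 + w2\<^sup>2) + 131072 * (3 * w1 * w2\<^sup>2 - w1 ^ 3),
          65536 * (w1\<^sup>2 + w2\<^sup>2)\<^sup>2:]" for w1 w2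
      unfolding 1(2) on_line_disc1' by (simp add: power2_eq_square power3_eq_cube algebra_simps \<sigma>)
    have tangent: "on_line disc1' P (1, - \<sigma>) = [:0, 0, 0, - 524288, 1048576:]"
      unfolding 1(2) on_line_disc1' by (simp add: power2_eq_square power3_eq_cube algebra_simps \<sigma>)
    have "cusp disc1' P"
    proof (rule cuspI[OF _ intersection_mult_3[OF tangent]])
      fix w1 w2 assume w: "1 * w2 \<noteq> - \<sigma> * w1"
      show "intersection_mult disc1' P (w1, w2) 2"
        by (rule intersection_mult_2[OF line]) (use w in \<open>simp add: add_eq_0_iff2\<close>)
    qed simp_all
    then show ?thesis by simp
  next
    case 2
    have line: "on_line disc1' P (w1, w2) =
        [:0, 0, 442368 * w2\<^sup>2,
          196608 * w1 * (w1\<^sup>2 + w2\<^sup>2) + 131072 * (3 * w1 * w2\<^sup>2 - w1 ^ 3),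
          65536 * (w1\<^sup>2 + w2\<^sup>2)\<^sup>2:]" for w1 w2
      unfolding 2 on_line_disc1' by (simp add: power2_eq_square power3_eq_cube algebra_simps)
    have tangent: "on_line disc1' P (1, 0) = [:0, 0, 0, 65536, 65536:]"
      unfolding 2 on_line_disc1' by (simp add: power2_eq_square power3_eq_cube algebra_simps)
    have "cusp disc1' P"
    proof (rule cuspI[OF _ intersection_mult_3[OF tangent]])
      fix w1 w2 :: real assume w: "1 * w2 \<noteq> 0 * w1"
      show "intersection_mult disc1' P (w1, w2) 2"
        by (rule intersection_mult_2[OF line]) (use w in simp)
    qed simp_all
    then show ?thesis by simp
  qed
qed

lemma cusp_images:
  "mapping f1 (1 / 2, 1 / 2) = (3 / 4, 3 / 4 :: real)"
  "mapping f1' (- 1 / 4, - sqrt 3 / 4) = (- 3 / 8, 3 * sqrt 3 / 8)"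
  "mapping f1' (- 1 / 4, sqrt 3 / 4) = (- 3 / 8, - 3 * sqrt 3 / 8)"
  "mapping f1' (1 / 2, 0) = (3 / 4, 0 :: real)"
  by (simp_all add: mapping_def f1_def f1'_def power_divide)

section \<open>The decomposition of the generic complex orbit\<close>

theorem mainTheorem11:
  shows
    "real_part_of_orbit f1 = orbit (f1 :: real polymap) \<union> orbit (f1' :: real polymap)
   \<and> orbit (f1 :: real polymap) \<inter> orbit (f1' :: real polymap) = {}
   \<and> semialgebraic_in_Omega22 (orbit (f1 :: real polymap))
   \<and> semialgebraic_in_Omega22 (orbit (f1' :: real polymap))
   \<and> orbit (f1 :: real polymap) = {f \<in> real_part_of_orbit f1. Phi1 f < 0}
   \<and> orbit (f1' :: real polymap) = {f \<in> real_part_of_orbit f1. Phi1 f > 0}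

   \<and> critical_set f1 = {(x, y). 4 * x * y - 1 = 0} \<and> hyperbola (critical_set f1)
   \<and> discriminant f1 = zero_set disc1
   \<and> reduced_irreducible (disc1 :: real poly poly)
   \<and> reduced_irreducible (disc1 :: complex poly poly)
   \<and> {P. cusp (disc1 :: real poly poly) P} = {mapping f1 (1/2, 1/2)}

   \<and> critical_set f1' = {(x, y). 4 * x\<^sup>2 + 4 * y\<^sup>2 - 1 = 0} \<and> circle (critical_set f1')
   \<and> discriminant f1' = zero_set disc1'
   \<and> reduced_irreducible (disc1' :: real poly poly)
   \<and> reduced_irreducible (disc1' :: complex poly poly)
   \<and> {P. cusp (disc1' :: real poly poly) P} =
       {mapping f1' (-1/4, - sqrt 3 / 4), mapping f1' (-1/4, sqrt 3 / 4), mapping f1' (1/2, 0)}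
   \<and> card {P. cusp (disc1' :: real poly poly) P} = 3"
proof (intro conjI)
  show "real_part_of_orbit f1 = orbit (f1 :: real polymap) \<union> orbit (f1' :: real polymap)"
    unfolding set_eq_iff Un_iff real_part_of_orbit_f1_iff real_orbit_f1_iff real_orbit_f1'_iff
    by (metis linorder_neq_iff)
  show "orbit (f1 :: real polymap) \<inter> orbit (f1' :: real polymap) = {}"
    unfolding set_eq_iff Int_iff real_orbit_f1_iff real_orbit_f1'_iff
    by (metis empty_iff order_less_asym)
  show "orbit (f1 :: real polymap) = {f \<in> real_part_of_orbit f1. Phi1 f < 0}"
    unfolding set_eq_iff mem_Collect_eq real_part_of_orbit_f1_iff real_orbit_f1_iff
    by (metis less_irrefl)
  show "orbit (f1' :: real polymap) = {f \<in> real_part_of_orbit f1. Phi1 f > 0}"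
    unfolding set_eq_iff mem_Collect_eq real_part_of_orbit_f1_iff real_orbit_f1'_iff
    by (metis less_irrefl)
  show "hyperbola (critical_set f1)"
    unfolding critical_set_f1 by (rule hyperbola_xy)
  show "circle (critical_set f1')"
    unfolding critical_set_f1' by (rule circle_half)
  show "reduced_irreducible (disc1 :: real poly poly)" "reduced_irreducible (disc1 :: complex poly poly)"
    "reduced_irreducible (disc1' :: real poly poly)" "reduced_irreducible (disc1' :: complex poly poly)"
    unfolding reduced_irreducible_def
    by (intro conjI irreducible_imp_squarefree irreducible_disc1
        irreducible_disc1'_real irreducible_disc1'_complex)+
  show "{P. cusp (disc1 :: real poly poly) P} = {mapping f1 (1/2, 1/2)}"
    unfolding cusps_disc1 cusp_images ..
  show cusps: "{P. cusp (disc1' :: real poly poly) P} =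
      {mapping f1' (-1/4, - sqrt 3 / 4), mapping f1' (-1/4, sqrt 3 / 4), mapping f1' (1/2, 0)}"
    unfolding cusps_disc1' cusp_images ..
  show "card {P. cusp (disc1' :: real poly poly) P} = 3"
    unfolding cusps_disc1' by simp
qed (fact semialgebraic_orbits critical_set_f1 critical_set_f1' discriminant_f1 discriminant_f1')+

end
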